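(* Let $G=(V,E)$ be a finite directed graph with $m=|E|$ edges, $u\in V$ a query node, $c\in(0,1)$ a fixed constant decay factor, $\epsilon\in(0,1)$ an error parameter and $\delta\in(0,1)$ a failure probability. In expectation, the algorithm SimPush (described in the context), run on $(G,u,c,\epsilon,\delta)$, runs in $$O\!\left(\frac{m\log\frac1\epsilon}{\epsilon}+\frac{\log\frac{1}{\epsilon\delta}}{\epsilon^2}+\frac1{\epsilon^3}\right)$$ time.
   Context: Running time is counted in elementary operations (unit-cost RAM; the graph is given by in- and out-adjacency lists; sampling a uniformly random in-neighbor costs $O(1)$). The decay factor $c$ is a constant, so constants in $O(\cdot)$ may depend on $c$. **Notation.** For a node $x$, $\mathcal I(x)$ and $\mathcal O(x)$ are its sets of in-neighbors and out-neighbors in $G$ and $d_{\mathcal I}(x)=|\mathcal I(x)|$. A $\sqrt c$-walk from $x$ is a random walk which, at each step, stops at the current node with probability $1-\sqrt c$ and otherwise (probability $\sqrt c$) jumps to a uniformly random in-neighbor of the current node (it stops if there is none). $h^{(\ell)}(x,w)$ denotes the probability that a $\sqrt c$-walk from $x$ is at $w$ at its $\ell$-th step; $h^{(0)}(x,x)=1$. **Algorithm SimPush.** Put $\epsilon_h=\frac{1-\sqrt c}{3\sqrt c}\,\epsilon$, $L^*=\lfloor\log_{1/\sqrt c}(1/\epsilon_h)\rfloor$ and $X=\log\frac{1}{(1-\sqrt c)\epsilon_h\delta}$. All quantities not explicitly set are $0$ by default. *Stage 1 (Source-Push).* Generate $\lceil 2X/\epsilon_h^2\rceil$ independent $\sqrt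 c$-walks from $u$; let $H^{(l)}(u,v)$ be the number of them that are at $v$ at step $l$ ($l\ge1$). Let $L$ be the largest $l\geq 1$ for which some $v$ has $H^{(l)}(u,v)>0$ and $H^{(l)}(u,v)\ge X/\epsilon_h$ ($L=0$ if none), then replace $L$ by $\min(L,L^* )$. Starting from $h^{(0)}(u,u)=1$, for $\ell=0,\dots,L-1$, for every $v$ with $h^{(\ell)}(u,v)>0$ and every $v'\in\mathcal I(v)$, add $\frac{\sqrt c\,h^{(\ell)}(u,v)}{d_{\mathcal I}(v)}$ to $h^{(\ell+1)}(u,v')$, and record in the *source graph* $G_u$ the node $v$ on level $\ell$, the node $v'$ on level $\ell+1$ and an edge from $v'$ (level $\ell+1$) to $v$ (level $\ell$). (Copies of the same node on different levels are distinct in $G_u$.) For $1\le\ell\le L$ let $A_u^{(\ell)}$ (the *attention nodes* on level $\ell$) be the set of nodes $w$ on level $\ell$ of $G_u$ with $h^{(\ell)}(u,w)\ge\epsilon_h$. *Stage 2 (last-meeting probabilities).* (a) For $\ell=L,\dots,2$: set $\tilde h^{(0)}(w,w)=1$ for each attention node $w$ on level $\ell$; then for each node $w'$ on level $\ell$ of $G_u$, each attention node $w_i$ on level $\ell+i$ with $\tilde h^{(i)}(w',w_i)\neq0$ ($i\ge0$), and each out-neighbor $w'_a$ of $w'$ in $G_u$ (on level $\ell-1$), add $\frac{\sqrt c}{d_{\mathcal I}(w'_a)}\tilde h^{(i)}(w',w_i)$ to $\tilde h^{(i+1)}(w'_a,w_i)$. (b) For each $w\in A_u^{(\ell)}$,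 $1\le\ell\le L$: for $i=1,\dots,L-\ell$ and each $w_i\in A_u^{(\ell+i)}$ compute $$\rho^{(i)}(w,w_i)=\tilde h^{(i)}(w,w_i)^2-\sum_{j=1}^{i-1}\sum_{w_j\in A_u^{(\ell+j)}}\rho^{(j)}(w,w_j)\,\tilde h^{(i-j)}(w_j,w_i)^2,$$ iterating over nonzero terms only, and then $\gamma^{(\ell)}(w)=1-\sum_{i=1}^{L-\ell}\sum_{w_i\in A_u^{(\ell+i)}}\rho^{(i)}(w,w_i)$. Set the initial residue $r^{(\ell)}(w)=h^{(\ell)}(u,w)\,\gamma^{(\ell)}(w)$. *Stage 3 (Reverse-Push).* Set $\tilde s(u,v)=0$ for all $v\in V$. For $\ell'=L,L-1,\dots,1$: for each node $v'$ with $\sqrt c\, r^{(\ell')}(v')\ge\epsilon_h$ and each $v\in\mathcal O(v')$ (in $G$), add $\frac{\sqrt c\,r^{(\ell')}(v')}{d_{\mathcal I}(v)}$ to $r^{(\ell'-1)}(v)$ if $\ell'>1$, and to $\tilde s(u,v)$ if $\ell'=1$. Finally set $\tilde s(u,u)=1$ and output $\tilde s(u,v)$ for all $v\in V$.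
   Formalization: The bound is proved for ε ≤ ε₀ with any fixed ε₀ < 1 and a constant depending on c and ε₀ (as ε→1 the m·log(1/ε) term vanishes and a uniform bound fails); setting and outputting scores of isolated nodes is not charged (else m=0 with many nodes refutes it). *)

theory Defs
  imports
    "HOL-Probability.Probability"
    "HOL-Library.Monad_Syntax"
    "Graph_Theory.Pair_Digraph"
begin

text \<open>
  A deterministic timed computation returns its result together with the number of elementary
  operations it has executed.  Every assignment (with the constantly many arithmetic operations,
  comparisons and table lookups on its right-hand side and in the test guarding it) is charged
  one operation by \<open>charge\<close>; every loop iteration and every final loop test is charged one more.
\<close>

type_synonym 'a timed = "'a \<times> nat"

definition ret :: "'a \<Rightarrow> 'a timed" where
  "ret x = (x, 0)"

definition charge :: "'a \<Rightarrow> 'a timed" where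
  "charge x = (x, 1)"

definition bind_timed :: "'a timed \<Rightarrow> ('a \<Rightarrow> 'b timed) \<Rightarrow> 'b timed" where
  "bind_timed p f = (case p of (x, t) \<Rightarrow> case f x of (y, t') \<Rightarrow> (y, t + t'))"

primrec for_each :: "'b list \<Rightarrow> ('b \<Rightarrow> 's \<Rightarrow> 's timed) \<Rightarrow> 's \<Rightarrow> 's timed" where
  "for_each [] body s = charge s"
| "for_each (x # xs) body s =
     bind_timed (charge s) (\<lambda>s. bind_timed (body x s) (for_each xs body))"

text \<open>
  Randomised timed computations are sub-probability distributions over pairs of result and
  operation count; the missing mass is the probability of non-termination.
\<close>

type_synonym 'a rand_timed = "('a \<times> nat) spmf"

definition lift_timed :: "'a timed \<Rightarrow> 'a rand_timed" where
  "lift_timed p = return_spmf p"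

definition sample :: "'a spmf \<Rightarrow> 'a rand_timed" where
  "sample p = map_spmf charge p"

definition bind_rand :: "'a rand_timed \<Rightarrow> ('a \<Rightarrow> 'b rand_timed) \<Rightarrow> 'b rand_timed" where
  "bind_rand p f = bind_spmf p (\<lambda>(x, t). map_spmf (\<lambda>(y, t'). (y, t + t')) (f x))"

adhoc_overloading
  Monad_Syntax.bind \<rightleftharpoons> bind_timed bind_rand

lemma bind_rand_mono [partial_function_mono]:
  assumes "mono_spmf B" and "\<And>y. mono_spmf (\<lambda>f. C y f)"
  shows "mono_spmf (\<lambda>f. bind_rand (B f) (\<lambda>y. C y f))"
  unfolding bind_rand_def map_spmf_conv_bind_spmf split_def
  by (intro partial_function_mono assms)

text \<open>A non-terminating run counts as infinitely long.\<close>

definition expected_time :: "'a rand_timed \<Rightarrow> ennreal" where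
  "expected_time p =
     (\<integral>\<^sup>+ z. (case z of None \<Rightarrow> \<infinity> | Some (_, t) \<Rightarrow> ennreal (real t)) \<partial>measure_pmf p)"

text \<open>
  A table whose entries are \<open>0\<close> by default, with the duplicate-free list of the keys that have
  been set explicitly.  Reading, setting and adding are elementary operations: on the RAM, the
  test \<open>k \<in> set (keys s)\<close> is a lookup of a mark.
\<close>

datatype ('k, 'b) sparse = Sparse (val: "'k \<Rightarrow> 'b") (keys: "'k list")

definition empty_sparse :: "('k, 'b::zero) sparse" where
  "empty_sparse = Sparse (\<lambda>_. 0) []"

definition set_at :: "'k \<Rightarrow> 'b \<Rightarrow> ('k, 'b) sparse \<Rightarrow> ('k, 'b) sparse" where
  "set_at k x s =
     Sparse ((val s)(k := x)) (if k \<in> set (keys s) then keys s else k # keys s)"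

definition add_at :: "'k \<Rightarrow> 'b::plus \<Rightarrow> ('k, 'b) sparse \<Rightarrow> ('k, 'b) sparse" where
  "add_at k x s = set_at k (val s k + x) s"

text \<open>
  The input: in- and out-adjacency lists, and the list of the nodes that occur in them.
  An isolated node occurs in no adjacency list and costs nothing; if loops over all nodes were
  charged for isolated nodes, no time bound in terms of the number of edges could hold.
\<close>

record 'v adjacency =
  node_list :: "'v list"
  in_list :: "'v \<Rightarrow> 'v list"
  out_list :: "'v \<Rightarrow> 'v list"

definition represents :: "'v adjacency \<Rightarrow> 'v pair_pre_digraph \<Rightarrow> bool" where
  "represents A G \<longleftrightarrow>
     distinct (node_list A) \<and>
     set (node_list A) = {v \<in> pverts G. \<exists>w. (v, w) \<in> parcs G \<or> (w, v) \<in> parcs G} \<and>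
     (\<forall>v \<in> pverts G.
        distinct (in_list A v) \<and> set (in_list A v) = {w. (w, v) \<in> parcs G} \<and>
        distinct (out_list A v) \<and> set (out_list A v) = {w. (v, w) \<in> parcs G})"

definition in_degree :: "'v adjacency \<Rightarrow> 'v \<Rightarrow> nat" where
  "in_degree A v = length (in_list A v)"

definition eps_h :: "real \<Rightarrow> real \<Rightarrow> real" where
  "eps_h c \<epsilon> = (1 - sqrt c) / (3 * sqrt c) * \<epsilon>"

text \<open>If the logarithm is negative, the truncation to \<open>0\<close> is harmless: there is no level to process.\<close>

definition L_star :: "real \<Rightarrow> real \<Rightarrow> nat" where
  "L_star c \<epsilon> = nat \<lfloor>log (1 / sqrt c) (1 / eps_h c \<epsilon>)\<rfloor>"

definition X_param :: "real \<Rightarrow> real \<Rightarrow> real \<Rightarrow> real" where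
  "X_param c \<epsilon> \<delta> = ln (1 / ((1 - sqrt c) * eps_h c \<epsilon> * \<delta>))"

definition num_walks :: "real \<Rightarrow> real \<Rightarrow> real \<Rightarrow> nat" where
  "num_walks c \<epsilon> \<delta> = nat \<lceil>2 * X_param c \<epsilon> \<delta> / (eps_h c \<epsilon>)\<^sup>2\<rceil>"

text \<open>
  Continue a walk that is at \<open>x\<close> at step \<open>l\<close>; the table \<open>H\<close> counts at \<open>(l, v)\<close> the walks
  that are at \<open>v\<close> at step \<open>l \<ge> 1\<close>.
\<close>

partial_function (spmf) sqrt_walk ::
  "'v adjacency \<Rightarrow> real \<Rightarrow> nat \<Rightarrow> 'v \<Rightarrow> (nat \<times> 'v, nat) sparse \<Rightarrow> (nat \<times> 'v, nat) sparse rand_timed"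
where
  "sqrt_walk A c l x H = do {
     continues \<leftarrow> sample (spmf_of_pmf (bernoulli_pmf (sqrt c)));
     if continues \<and> in_list A x \<noteq> [] then do {
       y \<leftarrow> sample (spmf_of_set (set (in_list A x)));
       H \<leftarrow> lift_timed (charge (add_at (Suc l, y) 1 H));
       sqrt_walk A c (Suc l) y H
     } else lift_timed (charge H)
   }"

primrec sqrt_walks ::
  "nat \<Rightarrow> 'v adjacency \<Rightarrow> real \<Rightarrow> 'v \<Rightarrow> (nat \<times> 'v, nat) sparse \<Rightarrow> (nat \<times> 'v, nat) sparse rand_timed"
where
  "sqrt_walks 0 A c u H = lift_timed (charge H)"
| "sqrt_walks (Suc n) A c u H = do {
     H \<leftarrow> lift_timed (charge H);
     H \<leftarrow> sqrt_walk A c 0 u H;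
     sqrt_walks n A c u H
   }"

definition detect_level :: "(nat \<times> 'v, nat) sparse \<Rightarrow> real \<Rightarrow> nat \<Rightarrow> nat timed" where
  "detect_level H threshold Lmax = do {
     L \<leftarrow> for_each (keys H) (\<lambda>(l, v) L.
            charge (if val H (l, v) > 0 \<and> real (val H (l, v)) \<ge> threshold then max L l else L)) 0;
     charge (min L Lmax)
   }"

text \<open>
  In the pair \<open>(h, g)\<close>, the entry \<open>val (h l) v\<close> is the hitting probability of \<open>v\<close> at step \<open>l\<close>,
  \<open>keys (h l)\<close> is the list of the nodes on level \<open>l\<close> of the source graph, and \<open>g l v\<close> is the list
  of the out-neighbours (on level \<open>l - 1\<close>) of the node \<open>v\<close> on level \<open>l\<close>.
  All explicitly set entries of \<open>h\<close> are positive.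
\<close>

definition source_push ::
  "'v adjacency \<Rightarrow> real \<Rightarrow> 'v \<Rightarrow> nat \<Rightarrow>
     ((nat \<Rightarrow> ('v, real) sparse) \<times> (nat \<Rightarrow> 'v \<Rightarrow> 'v list)) timed"
where
  "source_push A c u L =
     for_each [0..<L] (\<lambda>l (h, g).
       for_each (keys (h l)) (\<lambda>v (h, g).
         for_each (in_list A v) (\<lambda>v' (h, g). do {
           h \<leftarrow> charge (h(Suc l :=
                  add_at v' (sqrt c * val (h l) v / real (in_degree A v)) (h (Suc l))));
           g \<leftarrow> charge (g(Suc l := (g (Suc l))(v' := v # g (Suc l) v')));
           ret (h, g)
         }) (h, g)) (h, g))
       ((\<lambda>_. empty_sparse)(0 := set_at u 1 empty_sparse), \<lambda>_ _. [])"

definition attention_nodes ::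
  "real \<Rightarrow> nat \<Rightarrow> (nat \<Rightarrow> ('v, real) sparse) \<Rightarrow> (nat \<Rightarrow> 'v list) timed"
where
  "attention_nodes eh L h =
     for_each [1..<Suc L] (\<lambda>l att.
       for_each (keys (h l)) (\<lambda>w att.
         charge (if val (h l) w \<ge> eh then att(l := w # att l) else att)) att)
       (\<lambda>_. [])"

text \<open>
  For the copy of a node \<open>w\<close> on level \<open>l\<close> of the source graph and a node \<open>w\<^sub>i\<close> on level \<open>l + i\<close>,
  the hitting probability inside the source graph is \<open>val (ht l w) (i, w\<^sub>i)\<close>.
\<close>

type_synonym 'v hit_table = "nat \<Rightarrow> 'v \<Rightarrow> (nat \<times> 'v, real) sparse"

definition update_hit ::
  "nat \<Rightarrow> 'v \<Rightarrow> ((nat \<times> 'v, real) sparse \<Rightarrow> (nat \<times> 'v, real) sparse) \<Rightarrow>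
     'v hit_table \<Rightarrow> 'v hit_table"
where
  "update_hit l w f ht = ht(l := (ht l)(w := f (ht l w)))"

definition graph_hits ::
  "'v adjacency \<Rightarrow> real \<Rightarrow> nat \<Rightarrow> (nat \<Rightarrow> ('v, real) sparse) \<Rightarrow> (nat \<Rightarrow> 'v \<Rightarrow> 'v list) \<Rightarrow>
     (nat \<Rightarrow> 'v list) \<Rightarrow> 'v hit_table timed"
where
  "graph_hits A c L h g att =
     for_each (rev [2..<Suc L]) (\<lambda>l ht. do {
       ht \<leftarrow> for_each (att l) (\<lambda>w ht. charge (update_hit l w (set_at (0, w) 1) ht)) ht;
       for_each (keys (h l)) (\<lambda>w' ht.
         for_each (keys (ht l w')) (\<lambda>(i, wi) ht.
           for_each (g l w') (\<lambda>wa ht.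
             charge (update_hit (l - 1) wa
               (add_at (Suc i, wi)
                  (sqrt c / real (in_degree A wa) * val (ht l w') (i, wi))) ht)) ht) ht) ht
     }) (\<lambda>_ _. empty_sparse)"

text \<open>
  Only the nonzero \<open>\<rho>\<close> are stored, so the innermost loop and the final loop range over nonzero
  terms.
\<close>

definition last_meeting ::
  "nat \<Rightarrow> (nat \<Rightarrow> 'v list) \<Rightarrow> 'v hit_table \<Rightarrow> nat \<Rightarrow> 'v \<Rightarrow> real timed"
where
  "last_meeting L att ht l w = do {
     \<rho> \<leftarrow> for_each [1..<Suc (L - l)] (\<lambda>i \<rho>.
       for_each (att (l + i)) (\<lambda>wi \<rho>. do {
         q \<leftarrow> charge ((val (ht l w) (i, wi))\<^sup>2);
         q \<leftarrow> for_each [1..<i] (\<lambda>j q.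
           for_each (keys (\<rho> j)) (\<lambda>wj q.
             charge (if val (ht (l + j) wj) (i - j, wi) \<noteq> 0
                     then q - val (\<rho> j) wj * (val (ht (l + j) wj) (i - j, wi))\<^sup>2
                     else q)) q) q;
         charge (if q \<noteq> 0 then \<rho>(i := set_at wi q (\<rho> i)) else \<rho>)
       }) \<rho>) (\<lambda>_. empty_sparse);
     for_each [1..<Suc (L - l)] (\<lambda>i \<gamma>.
       for_each (keys (\<rho> i)) (\<lambda>wi \<gamma>. charge (\<gamma> - val (\<rho> i) wi)) \<gamma>) 1
   }"

definition initial_residues ::
  "nat \<Rightarrow> (nat \<Rightarrow> ('v, real) sparse) \<Rightarrow> (nat \<Rightarrow> 'v list) \<Rightarrow> 'v hit_table \<Rightarrow>
     (nat \<Rightarrow> ('v, real) sparse) timed"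
where
  "initial_residues L h att ht =
     for_each [1..<Suc L] (\<lambda>l r.
       for_each (att l) (\<lambda>w r. do {
         \<gamma> \<leftarrow> last_meeting L att ht l w;
         charge (r(l := set_at w (val (h l) w * \<gamma>) (r l)))
       }) r) (\<lambda>_. empty_sparse)"

definition reverse_push ::
  "'v adjacency \<Rightarrow> real \<Rightarrow> real \<Rightarrow> nat \<Rightarrow> (nat \<Rightarrow> ('v, real) sparse) \<Rightarrow>
     ('v \<Rightarrow> real) timed"
where
  "reverse_push A c eh L r = do {
     s \<leftarrow> for_each (node_list A) (\<lambda>v s. charge (s(v := 0))) (\<lambda>_. 0);
     (r, s) \<leftarrow> for_each (rev [1..<Suc L]) (\<lambda>l (r, s).
       for_each (keys (r l)) (\<lambda>v' (r, s).
         if sqrt c * val (r l) v' \<ge> eh then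
           for_each (out_list A v') (\<lambda>v (r, s).
             let x = sqrt c * val (r l) v' / real (in_degree A v)
             in charge (if l > 1 then (r(l - 1 := add_at v x (r (l - 1))), s)
                        else (r, s(v := s v + x)))) (r, s)
         else charge (r, s)) (r, s)) (r, s);
     ret s
   }"

definition output_scores :: "'v adjacency \<Rightarrow> 'v \<Rightarrow> ('v \<Rightarrow> real) \<Rightarrow> ('v \<Rightarrow> real) timed" where
  "output_scores A u s = do {
     s \<leftarrow> charge (s(u := 1));
     out \<leftarrow> charge ((\<lambda>_. 0)(u := s u));
     for_each (node_list A) (\<lambda>v out. charge (out(v := s v))) out
   }"

definition simpush ::
  "'v adjacency \<Rightarrow> 'v \<Rightarrow> real \<Rightarrow> real \<Rightarrow> real \<Rightarrow> ('v \<Rightarrow> real) rand_timed"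
where
  "simpush A u c \<epsilon> \<delta> = do {
     eh \<leftarrow> lift_timed (charge (eps_h c \<epsilon>));
     Lmax \<leftarrow> lift_timed (charge (L_star c \<epsilon>));
     X \<leftarrow> lift_timed (charge (X_param c \<epsilon> \<delta>));
     n \<leftarrow> lift_timed (charge (num_walks c \<epsilon> \<delta>));
     H \<leftarrow> sqrt_walks n A c u empty_sparse;
     lift_timed (do {
       L \<leftarrow> detect_level H (X / eh) Lmax;
       (h, g) \<leftarrow> source_push A c u L;
       att \<leftarrow> attention_nodes eh L h;
       ht \<leftarrow> graph_hits A c L h g att;
       r \<leftarrow> initial_residues L h att ht;
       s \<leftarrow> reverse_push A c eh L r;
       output_scores A u s
     })
   }"

end

theory Submission
  imports Defs
begin

text \<open>
  The walks of stage 1 are geometrically short and there are \<open>O(log (1/(\<epsilon>\<delta>)) / \<epsilon>\<^sup>2)\<close> of them; the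
  number of nonzero counters never exceeds their total length.  Whatever the walks find, the
  remaining stages see at most \<open>L\<^sup>* = O(log (1/\<epsilon>))\<close> levels, and since the hitting probabilities
  on level \<open>l\<close> sum to at most \<open>\<surd>c\<^sup>l\<close>, there are \<open>K = O(1/\<epsilon>)\<close> attention nodes altogether.
  A sweep over a level costs \<open>O(m)\<close>, or \<open>O(m K)\<close> when every node carries an entry for each attention
  node, and the last-meeting recursion costs \<open>O(K + L)\<close> for each pair of attention nodes.
\<close>

section \<open>Cost bounds for deterministic computations\<close>

text \<open>Three obstacles shape the proof. Only stage 1 is random, but \<open>detect_level\<close>
  scans a random number of counters; this scan is charged to the walks in advance, as a potential of
  two operations per key, so that one functional bounds both. A run that never ends counts as
  infinitely long, so the inequality E \<le> 5 + s * E for the expected cost E of a walk proves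
  nothing by itself: E might be infinite. Hence costs are first cut off at a finite N. Finally,
  initialising and printing the scores takes time linear in the number of listed nodes for every
  \<epsilon>, while m * ln (1/\<epsilon>) / \<epsilon> tends to 0 as \<epsilon> tends to 1; on long
  directed cycles no single constant works for all \<epsilon> < 1. The constant is therefore chosen
  for \<epsilon> up to some \<open>\<epsilon>\<^sub>0\<close> below 1 and depends on
  \<open>c\<close> and \<open>\<epsilon>\<^sub>0\<close>. The resulting gap, ln (1/\<epsilon>) at
  least \<open>a\<^sub>0 = ln (1 / \<epsilon>\<^sub>0)\<close>, also absorbs the additive constants
  hidden in \<open>L_star\<close> and \<open>X_param\<close>.\<close>

definition runs_within :: "'a timed \<Rightarrow> nat \<Rightarrow> ('a \<Rightarrow> bool) \<Rightarrow> bool" where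
  "runs_within p t Q \<longleftrightarrow> snd p \<le> t \<and> Q (fst p)"

lemma runs_within_mono:
  assumes "runs_within p t Q" and "t \<le> t'" and "\<And>x. Q x \<Longrightarrow> Q' x"
  shows "runs_within p t' Q'"
  using assms by (auto simp: runs_within_def)

lemma runs_within_ret: "Q x \<Longrightarrow> runs_within (ret x) 0 Q"
  by (simp add: runs_within_def ret_def)

lemma runs_within_charge: "Q x \<Longrightarrow> runs_within (charge x) 1 Q"
  by (simp add: runs_within_def charge_def)

lemma runs_within_bind:
  assumes "runs_within p t Q" and "\<And>x. Q x \<Longrightarrow> runs_within (f x) t' R"
  shows "runs_within (bind_timed p f) (t + t') R"
  using assms by (force simp: runs_within_def bind_timed_def split: prod.splits)

lemma runs_within_charge_bind:
  assumes "runs_within (f x) t Q"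
  shows "runs_within (bind_timed (charge x) f) (1 + t) Q"
  using assms by (simp add: runs_within_def bind_timed_def charge_def split_beta)

text \<open>The invariant sees the list of elements processed so far, so it can count them, sum over
  them, or describe exactly what they have produced. The leading \<open>1\<close> is the final loop
  test.\<close>

lemma runs_within_for_each:
  assumes init: "I [] s"
    and step: "\<And>ys x zs s. xs = ys @ x # zs \<Longrightarrow> I ys s \<Longrightarrow>
                 runs_within (body x s) (cost x) (I (ys @ [x]))"
  shows "runs_within (for_each xs body s) (1 + (\<Sum>x\<leftarrow>xs. 1 + cost x)) (I xs)"
proof -
  have "runs_within (for_each zs body s) (1 + (\<Sum>x\<leftarrow>zs. 1 + cost x)) (I xs)"
    if "xs = ys @ zs" and "I ys s" for ys zs s
    using that
  proof (induction zs arbitrary: ys s)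
    case Nil
    then show ?case by (simp add: runs_within_charge[unfolded One_nat_def])
  next
    case (Cons x zs)
    have rest: "runs_within (bind_timed (body x s) (for_each zs body))
           (cost x + (1 + (\<Sum>x\<leftarrow>zs. 1 + cost x))) (I xs)"
      by (rule runs_within_bind[OF step[OF Cons.prems]]) (use Cons in auto)
    show ?case
      using runs_within_charge_bind[where f = "\<lambda>s. bind_timed (body x s) (for_each zs body)", OF rest]
      by (simp add: algebra_simps)
  qed
  from this[of "[]" xs s] init show ?thesis by simp
qed

lemma runs_within_for_each_inv:
  assumes "I s" and "\<And>x s. x \<in> set xs \<Longrightarrow> I s \<Longrightarrow> runs_within (body x s) (cost x) I"
  shows "runs_within (for_each xs body s) (1 + (\<Sum>x\<leftarrow>xs. 1 + cost x)) I"
  by (rule runs_within_for_each[where I = "\<lambda>_. I"]) (use assms in auto)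

section \<open>Table updates and list sums\<close>

lemma val_set_at [simp]: "val (set_at k x s) = (val s)(k := x)"
  by (simp add: set_at_def)

lemma val_add_at [simp]: "val (add_at k x s) = (val s)(k := val s k + x)"
  by (simp add: add_at_def)

lemma set_keys_set_at [simp]: "set (keys (set_at k x s)) = insert k (set (keys s))"
  by (auto simp: set_at_def)

lemma set_keys_add_at [simp]: "set (keys (add_at k x s)) = insert k (set (keys s))"
  by (simp add: add_at_def)

lemma distinct_keys_set_at [simp]: "distinct (keys (set_at k x s)) = distinct (keys s)"
  by (auto simp: set_at_def)

lemma distinct_keys_add_at [simp]: "distinct (keys (add_at k x s)) = distinct (keys s)"
  by (simp add: add_at_def)

lemma length_keys_add_at: "length (keys (add_at k x s)) \<le> Suc (length (keys s))"
  by (simp add: add_at_def set_at_def)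

lemma keys_empty_sparse [simp]: "keys empty_sparse = []"
  and val_empty_sparse [simp]: "val empty_sparse k = 0"
  by (simp_all add: empty_sparse_def)

text \<open>In a loop over levels starting at 0, the current level is the number of levels already
  done; an invariant indexed by the prefix can then be phrased by its length.\<close>

lemma upt_eq_append_conv_length:
  assumes "[0..<n] = ys @ l # zs"
  shows "l = length ys"
proof -
  have "length ys < n"
    using arg_cong[OF assms, of length] by simp
  then have "[0..<n] ! length ys = length ys"
    by simp
  then show ?thesis
    unfolding assms by simp
qed

lemma sum_list_le_mult:
  fixes f :: "'a \<Rightarrow> nat"
  assumes "\<And>x. x \<in> set xs \<Longrightarrow> f x \<le> b"
  shows "(\<Sum>x\<leftarrow>xs. f x) \<le> length xs * b"
  using assms by (induction xs) (auto intro: add_mono)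

section \<open>The deterministic stages\<close>

text \<open>The final \<open>min\<close> caps the level whatever the counters hold, so that
  worst-case bounds suffice for all later stages.\<close>

lemma detect_level_runs:
  "runs_within (detect_level H thr Lmax) (2 * length (keys H) + 2) (\<lambda>L. L \<le> Lmax)"
proof -
  have "runs_within (detect_level H thr Lmax)
          ((1 + (\<Sum>_\<leftarrow>keys H. 1 + 1)) + 1) (\<lambda>L. L \<le> Lmax)"
    unfolding detect_level_def
    by (rule runs_within_bind[OF runs_within_for_each_inv[where I = "\<lambda>_. True"]])
      (auto intro!: runs_within_charge[unfolded One_nat_def])
  then show ?thesis
    by (rule runs_within_mono) (auto simp: sum_list_triv)
qed

section \<open>Degree sums in a finite digraph\<close>

locale adjacency_digraph = pair_fin_digraph G for G :: "'v pair_pre_digraph" +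
  fixes A :: "'v adjacency"
  assumes represents: "represents A G"
begin

abbreviation m :: nat where "m \<equiv> card (parcs G)"

lemma arc_ends: "(v, w) \<in> parcs G \<Longrightarrow> v \<in> pverts G \<and> w \<in> pverts G"
  using in_arcsD1 in_arcsD2 by blast

lemma tails_subset: "fst ` parcs G \<subseteq> pverts G"
  using arc_ends by auto

lemma in_list:
  assumes "v \<in> pverts G"
  shows "distinct (in_list A v)" and "set (in_list A v) = {w. (w, v) \<in> parcs G}"
  using represents assms by (auto simp: represents_def)

lemma out_list:
  assumes "v \<in> pverts G"
  shows "distinct (out_list A v)" and "set (out_list A v) = {w. (v, w) \<in> parcs G}"
  using represents assms by (auto simp: represents_def)

lemma node_list:
  "distinct (node_list A)" "set (node_list A) = fst ` parcs G \<union> snd ` parcs G"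
proof -
  show "distinct (node_list A)"
    using represents by (simp add: represents_def)
  have "set (node_list A) = {v \<in> pverts G. \<exists>w. (v, w) \<in> parcs G \<or> (w, v) \<in> parcs G}"
    using represents by (simp add: represents_def)
  also have "\<dots> = fst ` parcs G \<union> snd ` parcs G"
    using arc_ends by (safe; force)
  finally show "set (node_list A) = fst ` parcs G \<union> snd ` parcs G" .
qed

lemma card_tails: "card (fst ` parcs G) \<le> m"
  by (rule card_image_le) simp

lemma length_node_list: "length (node_list A) \<le> 2 * m"
proof -
  have "length (node_list A) = card (fst ` parcs G \<union> snd ` parcs G)"
    using node_list distinct_card by metis
  also have "\<dots> \<le> card (fst ` parcs G) + card (snd ` parcs G)"
    by (rule card_Un_le)
  also have "\<dots> \<le> m + m"
    by (intro add_mono card_image_le) simp_all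
  finally show ?thesis by simp
qed

text \<open>Pairs of a node and an in-neighbour inject into the arcs once their components are
  swapped. Thus a sweep over distinct nodes pays at most \<open>m\<close> for all their adjacency
  lists together.\<close>

lemma sum_in_degree:
  assumes "S \<subseteq> pverts G"
  shows "(\<Sum>v\<in>S. length (in_list A v)) \<le> m"
proof -
  have fin: "finite S"
    using assms pair_finite_verts finite_subset by blast
  have "(\<Sum>v\<in>S. length (in_list A v)) = (\<Sum>v\<in>S. card (set (in_list A v)))"
    using assms in_list by (intro sum.cong) (auto simp: distinct_card[symmetric])
  also have "\<dots> = card (SIGMA v:S. set (in_list A v))"
    using fin by (simp add: card_SigmaI)
  also have "\<dots> \<le> m"
    by (rule card_inj_on_le[where f = prod.swap]) (use assms in_list in auto)
  finally show ?thesis .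
qed

lemma sum_out_degree:
  assumes "S \<subseteq> pverts G"
  shows "(\<Sum>v\<in>S. length (out_list A v)) \<le> m"
proof -
  have fin: "finite S"
    using assms pair_finite_verts finite_subset by blast
  have "(\<Sum>v\<in>S. length (out_list A v)) = (\<Sum>v\<in>S. card (set (out_list A v)))"
    using assms out_list by (intro sum.cong) (auto simp: distinct_card[symmetric])
  also have "\<dots> = card (SIGMA v:S. set (out_list A v))"
    using fin by (simp add: card_SigmaI)
  also have "\<dots> \<le> m"
    by (rule card_mono) (use assms out_list in auto)
  finally show ?thesis .
qed

section \<open>Source push: mass and size of each level\<close>

definition level_ok :: "real \<Rightarrow> nat \<Rightarrow> ('v, real) sparse \<Rightarrow> ('v \<Rightarrow> 'v list) \<Rightarrow> bool" where
  "level_ok c l hs gs \<longleftrightarrow>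
     distinct (keys hs) \<and> set (keys hs) \<subseteq> pverts G \<and> (l > 0 \<longrightarrow> set (keys hs) \<subseteq> fst ` parcs G) \<and>
     (\<forall>v. 0 \<le> val hs v) \<and> (\<Sum>v\<in>pverts G. val hs v) \<le> sqrt c ^ l \<and>
     (\<Sum>v\<in>pverts G. length (gs v)) \<le> m"

text \<open>Nodes on a positive level were reached as in-neighbours, so they are tails of arcs.
  Counting tails gives \<open>m\<close>, where counting nodes would give the number of vertices.
  Level 0 is exempt: it holds \<open>u\<close>, which may have no out-neighbour.\<close>

lemma level_ok_length_keys:
  assumes "level_ok c l hs gs" and "l > 0"
  shows "length (keys hs) \<le> m"
proof -
  have "length (keys hs) = card (set (keys hs))"
    using assms by (simp add: level_ok_def distinct_card)
  also have "\<dots> \<le> card (fst ` parcs G)"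
    by (rule card_mono) (use assms in \<open>auto simp: level_ok_def\<close>)
  also have "\<dots> \<le> m"
    by (rule card_tails)
  finally show ?thesis .
qed

text \<open>Emptiness above level \<open>l\<close> lets the next round start with zero mass and no
  arcs. The explicit \<open>keys (h 0)\<close> supplies the length of level 0, which the count of
  tails does not cover.\<close>

definition push_state_ok ::
  "real \<Rightarrow> 'v \<Rightarrow> nat \<Rightarrow> (nat \<Rightarrow> ('v, real) sparse) \<times> (nat \<Rightarrow> 'v \<Rightarrow> 'v list) \<Rightarrow> bool"
where
  "push_state_ok c u l = (\<lambda>(h, g).
     keys (h 0) = [u] \<and> (\<forall>k \<le> l. level_ok c k (h k) (g k)) \<and>
     (\<forall>k > l. h k = empty_sparse \<and> g k = (\<lambda>_. [])))"

text \<open>A level under construction that has received at most \<open>d\<close> arcs and total mass at most \<open>p\<close>.\<close>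

definition partial_level :: "nat \<Rightarrow> real \<Rightarrow> ('v, real) sparse \<Rightarrow> ('v \<Rightarrow> 'v list) \<Rightarrow> bool" where
  "partial_level d p hs gs \<longleftrightarrow>
     distinct (keys hs) \<and> set (keys hs) \<subseteq> fst ` parcs G \<and> (\<forall>v. 0 \<le> val hs v) \<and>
     (\<Sum>v\<in>pverts G. val hs v) \<le> p \<and> (\<Sum>v\<in>pverts G. length (gs v)) \<le> d"

text \<open>A sweep reads level \<open>l\<close> while it writes level \<open>Suc l\<close>.
  Describing the state as the initial one with only level \<open>Suc l\<close> replaced makes every
  value read constant during the sweep.\<close>

definition push_state_partial ::
  "nat \<Rightarrow> nat \<Rightarrow> real \<Rightarrow> (nat \<Rightarrow> ('v, real) sparse) \<times> (nat \<Rightarrow> 'v \<Rightarrow> 'v list) \<Rightarrow>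
     (nat \<Rightarrow> ('v, real) sparse) \<times> (nat \<Rightarrow> 'v \<Rightarrow> 'v list) \<Rightarrow> bool"
where
  "push_state_partial l d p s\<^sub>0 s \<longleftrightarrow>
     (\<exists>hs gs. s = ((fst s\<^sub>0)(Suc l := hs), (snd s\<^sub>0)(Suc l := gs)) \<and> partial_level d p hs gs)"

lemma partial_level_add_arc:
  assumes ok: "partial_level d p hs gs" and v': "v' \<in> fst ` parcs G" and x: "x \<ge> 0"
  shows "partial_level (d + 1) (p + x) (add_at v' x hs) (gs(v' := v # gs v'))"
proof -
  have v'_vert: "v' \<in> pverts G" using v' tails_subset by blast
  have "(\<Sum>w\<in>pverts G. val (add_at v' x hs) w)
      = (\<Sum>w\<in>pverts G. val hs w + (if w = v' then x else 0))"
    by (intro sum.cong) auto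
  also have "\<dots> = (\<Sum>w\<in>pverts G. val hs w) + x"
    using v'_vert by (simp only: sum.distrib sum.delta pair_finite_verts if_True)
  finally have "(\<Sum>w\<in>pverts G. val (add_at v' x hs) w) \<le> p + x"
    using ok unfolding partial_level_def by linarith
  moreover have "(\<Sum>w\<in>pverts G. length ((gs(v' := v # gs v')) w))
      = (\<Sum>w\<in>pverts G. length (gs w) + (if w = v' then 1 else 0))"
    by (intro sum.cong) auto
  then have "(\<Sum>w\<in>pverts G. length ((gs(v' := v # gs v')) w)) = (\<Sum>w\<in>pverts G. length (gs w)) + 1"
    using v'_vert by (simp only: sum.distrib sum.delta pair_finite_verts if_True)
  then have "(\<Sum>w\<in>pverts G. length ((gs(v' := v # gs v')) w)) \<le> d + 1"
    using ok unfolding partial_level_def by linarith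
  moreover have "distinct (keys (add_at v' x hs))" "set (keys (add_at v' x hs)) \<subseteq> fst ` parcs G"
    "\<forall>w. 0 \<le> val (add_at v' x hs) w"
    using ok v' x by (simp_all add: partial_level_def)
  ultimately show ?thesis
    unfolding partial_level_def by (intro conjI)
qed

lemma push_state_partial_add_arc:
  assumes "push_state_partial l d p s\<^sub>0 (h, g)" and "v' \<in> fst ` parcs G" and "x \<ge> 0"
  shows "push_state_partial l (d + 1) (p + x) s\<^sub>0
     (h(Suc l := add_at v' x (h (Suc l))), g(Suc l := (g (Suc l))(v' := v # g (Suc l) v')))"
proof -
  from assms(1) obtain hs gs where
    hg: "h = (fst s\<^sub>0)(Suc l := hs)" "g = (snd s\<^sub>0)(Suc l := gs)" and "partial_level d p hs gs"
    by (auto simp: push_state_partial_def)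
  from partial_level_add_arc[OF this(3) assms(2,3), of v] show ?thesis
    unfolding push_state_partial_def hg
    by (intro exI[of _ "add_at v' x hs"] exI[of _ "gs(v' := v # gs v')"]) simp
qed

lemma push_state_partial_mono:
  assumes "push_state_partial l d p s\<^sub>0 s" and "d \<le> d'" and "p \<le> p'"
  shows "push_state_partial l d' p' s\<^sub>0 s"
proof -
  have "partial_level d' p' hs gs" if "partial_level d p hs gs" for hs gs
    using that order_trans[OF _ assms(2)] order_trans[OF _ assms(3)]
    unfolding partial_level_def by blast
  then show ?thesis
    using assms(1) unfolding push_state_partial_def by blast
qed

text \<open>An arc costs three operations (loop iteration and two assignments), a node two more (its
  iteration and the final test of its inner loop). A level has at most \<open>m + 1\<close> nodes of
  total in-degree at most \<open>m\<close>, so a sweep costs at most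
  \<open>1 + 2 * (m + 1) + 3 * m\<close>.\<close>

lemma source_push_runs:
  assumes u: "u \<in> pverts G" and c: "0 < c" "c < 1"
  shows "runs_within (source_push A c u L) (1 + L * (4 + 5 * m)) (push_state_ok c u L)"
proof -
  have init: "push_state_ok c u 0
      ((\<lambda>_. empty_sparse)(0 := set_at u 1 empty_sparse), \<lambda>_ _. [])"
  proof -
    have "(\<Sum>v\<in>pverts G. val (set_at u 1 empty_sparse) v) = (1::real)"
    proof -
      have "(\<Sum>v\<in>pverts G. val (set_at u 1 empty_sparse) v)
          = (\<Sum>v\<in>pverts G. if v = u then 1 else 0::real)"
        by (intro sum.cong) auto
      then show ?thesis using u by simp
    qed
    then show ?thesis
      using u by (simp add: push_state_ok_def level_ok_def) (simp add: set_at_def)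
  qed
  let ?arc = "\<lambda>l v v' (h, g). do {
           h \<leftarrow> charge (h(Suc l :=
                  add_at v' (sqrt c * val (h l) v / real (in_degree A v)) (h (Suc l))));
           g \<leftarrow> charge (g(Suc l := (g (Suc l))(v' := v # g (Suc l) v')));
           ret (h :: nat \<Rightarrow> ('v, real) sparse, g :: nat \<Rightarrow> 'v \<Rightarrow> 'v list)
         }"
  have level: "runs_within
      (for_each (keys (h\<^sub>0 l)) (\<lambda>v (h, g). for_each (in_list A v) (?arc l v) (h, g)) (h\<^sub>0, g\<^sub>0))
      (3 + 5 * m) (push_state_ok c u (Suc l))"
    if ok: "push_state_ok c u l (h\<^sub>0, g\<^sub>0)" for l h\<^sub>0 g\<^sub>0
  proof -
    let ?K = "keys (h\<^sub>0 l)"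
    have lok: "level_ok c l (h\<^sub>0 l) (g\<^sub>0 l)"
      and emp: "h\<^sub>0 (Suc l) = empty_sparse" "g\<^sub>0 (Suc l) = (\<lambda>_. [])"
      using ok by (auto simp: push_state_ok_def)
    have node: "runs_within (for_each (in_list A v) (?arc l v) s)
        (1 + 3 * in_degree A v)
        (push_state_partial l (d + in_degree A v) (p + sqrt c * val (h\<^sub>0 l) v) (h\<^sub>0, g\<^sub>0))"
      if v: "v \<in> set ?K" and s: "push_state_partial l d p (h\<^sub>0, g\<^sub>0) s" for v d p s
    proof -
      have vV: "v \<in> pverts G" using v lok by (auto simp: level_ok_def)
      define x where "x = sqrt c * val (h\<^sub>0 l) v / real (in_degree A v)"
      have x: "x \<ge> 0" using lok c by (simp add: x_def level_ok_def)
      have "runs_within (for_each (in_list A v) (?arc l v) s)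
          (1 + (\<Sum>_\<leftarrow>in_list A v. 1 + (1 + (1 + 0))))
          ((\<lambda>ys. push_state_partial l (d + length ys) (p + length ys * x) (h\<^sub>0, g\<^sub>0)) (in_list A v))"
      proof (rule runs_within_for_each)
        fix ys v' zs s
        assume v': "in_list A v = ys @ v' # zs"
          and pl: "push_state_partial l (d + length ys) (p + length ys * x) (h\<^sub>0, g\<^sub>0) s"
        obtain h g where hg: "s = (h, g)" by force
        have v'_tail: "v' \<in> fst ` parcs G"
          using in_list[OF vV] v' by force
        have "h l = h\<^sub>0 l"
          using pl by (auto simp: push_state_partial_def hg)
        then have share: "sqrt c * val (h l) v / real (in_degree A v) = x"
          by (simp add: x_def)
        have mass: "p + length (ys @ [v']) * x = p + length ys * x + x"
          by (simp add: distrib_right)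
        have count: "d + length (ys @ [v']) = d + length ys + 1"
          by simp
        have *: "push_state_partial l (d + length (ys @ [v'])) (p + length (ys @ [v']) * x) (h\<^sub>0, g\<^sub>0)
         (h(Suc l := add_at v' (sqrt c * val (h l) v / real (in_degree A v)) (h (Suc l))),
          g(Suc l := (g (Suc l))(v' := v # g (Suc l) v')))"
          unfolding share mass count by (rule push_state_partial_add_arc[OF pl[unfolded hg] v'_tail x])
        show "runs_within (?arc l v v' s) (1 + (1 + 0))
            (push_state_partial l (d + length (ys @ [v'])) (p + length (ys @ [v']) * x) (h\<^sub>0, g\<^sub>0))"
          unfolding hg prod.case
          by (intro runs_within_charge_bind runs_within_ret *)
      qed (use s in simp)
      \<comment> \<open>Equality holds unless \<open>v\<close> has no in-neighbour; then nothing is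
        passed on and the mass at \<open>v\<close> is lost.\<close>
      moreover have "real (length (in_list A v)) * x \<le> sqrt c * val (h\<^sub>0 l) v"
        using lok c by (cases "in_list A v = []") (auto simp: x_def in_degree_def level_ok_def)
      ultimately show ?thesis
        by (elim runs_within_mono push_state_partial_mono) (simp_all add: sum_list_triv in_degree_def)
    qed
    have "runs_within
      (for_each ?K (\<lambda>v (h, g). for_each (in_list A v) (?arc l v) (h, g)) (h\<^sub>0, g\<^sub>0))
      (1 + (\<Sum>v\<leftarrow>?K. 1 + (1 + 3 * in_degree A v)))
      ((\<lambda>ys. push_state_partial l (\<Sum>v\<leftarrow>ys. in_degree A v) (\<Sum>v\<leftarrow>ys. sqrt c * val (h\<^sub>0 l) v) (h\<^sub>0, g\<^sub>0)) ?K)"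
    proof (rule runs_within_for_each)
      show "push_state_partial l (\<Sum>v\<leftarrow>[]. in_degree A v) (\<Sum>v\<leftarrow>[]. sqrt c * val (h\<^sub>0 l) v) (h\<^sub>0, g\<^sub>0) (h\<^sub>0, g\<^sub>0)"
        unfolding push_state_partial_def partial_level_def
        using emp by (intro exI[of _ empty_sparse] exI[of _ "\<lambda>_. []"]) (auto simp: fun_eq_iff)
    next
      fix ys v zs s
      assume v: "?K = ys @ v # zs"
        and pl: "push_state_partial l (\<Sum>v\<leftarrow>ys. in_degree A v) (\<Sum>v\<leftarrow>ys. sqrt c * val (h\<^sub>0 l) v) (h\<^sub>0, g\<^sub>0) s"
      show "runs_within ((\<lambda>(h, g). for_each (in_list A v) (?arc l v) (h, g)) s) (1 + 3 * in_degree A v)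
         (push_state_partial l (\<Sum>v\<leftarrow>ys @ [v]. in_degree A v) (\<Sum>v\<leftarrow>ys @ [v]. sqrt c * val (h\<^sub>0 l) v) (h\<^sub>0, g\<^sub>0))"
        using node[OF _ pl, of v] v by (cases s) simp
    qed
    then show ?thesis
    proof (rule runs_within_mono)
      have deg: "(\<Sum>v\<leftarrow>?K. in_degree A v) \<le> m"
        using lok sum_in_degree[of "set ?K"]
        by (simp add: level_ok_def sum_list_distinct_conv_sum_set in_degree_def)
      \<comment> \<open>The extra 1 is for level 0, whose single node \<open>u\<close> may be
        isolated.\<close>
      have len: "length ?K \<le> m + 1"
        using ok level_ok_length_keys[OF lok] by (cases l) (auto simp: push_state_ok_def)
      have "(\<Sum>v\<leftarrow>xs. 1 + (1 + 3 * in_degree A v)) = 2 * length xs + 3 * (\<Sum>v\<leftarrow>xs. in_degree A v)"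
        for xs
        by (induction xs) simp_all
      from this[of ?K] show "1 + (\<Sum>v\<leftarrow>?K. 1 + (1 + 3 * in_degree A v)) \<le> 3 + 5 * m"
        using deg len by linarith
      have "(\<Sum>v\<leftarrow>?K. sqrt c * val (h\<^sub>0 l) v) = sqrt c * (\<Sum>v\<in>set ?K. val (h\<^sub>0 l) v)"
        using lok by (simp only: level_ok_def sum_list_distinct_conv_sum_set sum_distrib_left)
      also have "\<dots> \<le> sqrt c * (\<Sum>v\<in>pverts G. val (h\<^sub>0 l) v)"
        using lok c by (intro mult_left_mono sum_mono2) (auto simp: level_ok_def)
      also have "\<dots> \<le> sqrt c ^ Suc l"
        using lok c by (simp add: level_ok_def)
      finally have mass: "(\<Sum>v\<leftarrow>?K. sqrt c * val (h\<^sub>0 l) v) \<le> sqrt c ^ Suc l" .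
      fix s
      assume "push_state_partial l (\<Sum>v\<leftarrow>?K. in_degree A v) (\<Sum>v\<leftarrow>?K. sqrt c * val (h\<^sub>0 l) v) (h\<^sub>0, g\<^sub>0) s"
      then obtain hs gs where s: "s = (h\<^sub>0(Suc l := hs), g\<^sub>0(Suc l := gs))"
        and "distinct (keys hs)" "set (keys hs) \<subseteq> fst ` parcs G" "\<forall>v. 0 \<le> val hs v"
        "(\<Sum>v\<in>pverts G. val hs v) \<le> (\<Sum>v\<leftarrow>?K. sqrt c * val (h\<^sub>0 l) v)"
        "(\<Sum>v\<in>pverts G. length (gs v)) \<le> (\<Sum>v\<leftarrow>?K. in_degree A v)"
        by (auto simp: push_state_partial_def partial_level_def)
      then have "level_ok c (Suc l) hs gs"
        using mass deg tails_subset unfolding level_ok_def by auto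
      then have "level_ok c k ((h\<^sub>0(Suc l := hs)) k) ((g\<^sub>0(Suc l := gs)) k)" if "k \<le> Suc l" for k
        using ok that by (cases "k = Suc l") (simp_all add: push_state_ok_def)
      with ok show "push_state_ok c u (Suc l) s"
        by (simp add: s push_state_ok_def)
    qed
  qed
  have "runs_within (source_push A c u L) (1 + (\<Sum>_\<leftarrow>[0..<L]. 1 + (3 + 5 * m)))
     ((\<lambda>ys. push_state_ok c u (length ys)) [0..<L])"
    unfolding source_push_def
  proof (rule runs_within_for_each)
    fix ys l zs s
    assume "[0..<L] = ys @ l # zs" and "push_state_ok c u (length ys) s"
    moreover from this(1) have "l = length ys"
      by (rule upt_eq_append_conv_length)
    ultimately show "runs_within ((\<lambda>(h, g). for_each (keys (h l))
        (\<lambda>v (h, g). for_each (in_list A v) (?arc l v) (h, g)) (h, g)) s)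
        (3 + 5 * m) (push_state_ok c u (length (ys @ [l])))"
      using level[of l] by (cases s) simp
  qed (use init in simp)
  then show ?thesis by (simp add: sum_list_triv)
qed


section \<open>Attention nodes and their number\<close>

definition attention_ok ::
  "nat \<Rightarrow> (nat \<Rightarrow> ('v, real) sparse) \<Rightarrow> real \<Rightarrow> (nat \<Rightarrow> 'v list) \<Rightarrow> bool"
where
  "attention_ok L h eh att \<longleftrightarrow> (\<forall>l. distinct (att l) \<and> set (att l) \<subseteq> set (keys (h l)) \<and>
     (\<forall>w\<in>set (att l). eh \<le> val (h l) w) \<and> (l \<notin> {1..L} \<longrightarrow> att l = []))"

lemma attention_nodes_runs:
  assumes h: "push_state_ok c u L (h, g)"
  shows "runs_within (attention_nodes eh L h) (1 + L * (2 + 2 * m)) (attention_ok L h eh)"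
proof -
  \<comment> \<open>The loop prepends, so each finished level carries the filtered key list in
    reverse; levels outside the processed prefix are still empty.\<close>
  let ?att = "\<lambda>ls l. if l \<in> set ls then rev (filter (\<lambda>w. eh \<le> val (h l) w) (keys (h l))) else []"
  have level: "level_ok c l (h l) (g l)" if "l \<le> L" for l
    using h that by (simp add: push_state_ok_def)
  have "runs_within (attention_nodes eh L h)
      (1 + (\<Sum>l\<leftarrow>[1..<Suc L]. 1 + (1 + (\<Sum>_\<leftarrow>keys (h l). 1 + 1))))
      ((\<lambda>ls att. att = ?att ls) [1..<Suc L])"
    unfolding attention_nodes_def
  proof (rule runs_within_for_each)
    fix ls l zs and att :: "nat \<Rightarrow> 'v list"
    assume ls: "[1..<Suc L] = ls @ l # zs" and att: "att = ?att ls"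
    \<comment> \<open>A level occurs once in the range, so its list is empty when its turn
      comes.\<close>
    have "distinct (ls @ l # zs)"
      unfolding ls[symmetric] by simp
    then have fresh: "l \<notin> set ls" by simp
    have "runs_within (for_each (keys (h l)) (\<lambda>w att.
            charge (if val (h l) w \<ge> eh then att(l := w # att l) else att)) att)
          (1 + (\<Sum>_\<leftarrow>keys (h l). 1 + 1))
          ((\<lambda>ws att'. att' = att(l := rev (filter (\<lambda>w. eh \<le> val (h l) w) ws))) (keys (h l)))"
      by (rule runs_within_for_each)
        (use fresh att in \<open>auto intro!: runs_within_charge[unfolded One_nat_def] simp: fun_eq_iff\<close>)
    then show "runs_within (for_each (keys (h l)) (\<lambda>w att.
            charge (if val (h l) w \<ge> eh then att(l := w # att l) else att)) att)
          (1 + (\<Sum>_\<leftarrow>keys (h l). 1 + 1)) (\<lambda>att. att = ?att (ls @ [l]))"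
      by (rule runs_within_mono) (auto simp: att)
  qed simp
  then show ?thesis
  proof (rule runs_within_mono)
    have "(\<Sum>l\<leftarrow>[1..<Suc L]. 1 + (1 + (\<Sum>_\<leftarrow>keys (h l). 1 + 1))) \<le> length [1..<Suc L] * (2 + 2 * m)"
    proof (rule sum_list_le_mult)
      fix l assume "l \<in> set [1..<Suc L]"
      then have "length (keys (h l)) \<le> m"
        using level_ok_length_keys[OF level[of l]] by auto
      then show "1 + (1 + (\<Sum>_\<leftarrow>keys (h l). 1 + 1)) \<le> 2 + 2 * m"
        by (simp add: sum_list_triv)
    qed
    then show "1 + (\<Sum>l\<leftarrow>[1..<Suc L]. 1 + (1 + (\<Sum>_\<leftarrow>keys (h l). 1 + 1))) \<le> 1 + L * (2 + 2 * m)"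
      by (simp del: upt_Suc)
    fix att
    assume "att = ?att [1..<Suc L]"
    then show "attention_ok L h eh att"
      using level unfolding attention_ok_def by (auto simp: level_ok_def)
  qed
qed

abbreviation num_attention :: "nat \<Rightarrow> (nat \<Rightarrow> 'v list) \<Rightarrow> nat" where
  "num_attention L att \<equiv> (\<Sum>l\<in>{1..L}. length (att l))"

text \<open>Markov's inequality on each level. Enlarging the sum over the levels to the whole
  geometric series makes the bound independent of \<open>L\<close>, hence of the outcome of the
  walks.\<close>

lemma num_attention_bound:
  assumes h: "push_state_ok c u L (h, g)" and att: "attention_ok L h eh att"
    and c: "0 < c" "c < 1" and eh: "0 < eh"
  shows "real (num_attention L att) \<le> 1 / ((1 - sqrt c) * eh)"
proof -
  have sc: "0 < sqrt c" "sqrt c < 1" using c by simp_all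
  have "real (length (att l)) * eh \<le> sqrt c ^ l" if "l \<in> {1..L}" for l
  proof -
    have lok: "level_ok c l (h l) (g l)"
      using h that by (simp add: push_state_ok_def)
    have "real (length (att l)) * eh = (\<Sum>_\<in>set (att l). eh)"
      using att by (simp add: attention_ok_def distinct_card)
    also have "\<dots> \<le> (\<Sum>w\<in>set (att l). val (h l) w)"
      using att by (intro sum_mono) (simp add: attention_ok_def)
    also have "\<dots> \<le> (\<Sum>w\<in>pverts G. val (h l) w)"
    proof (rule sum_mono2)
      show "set (att l) \<subseteq> pverts G"
        using att lok unfolding attention_ok_def level_ok_def by blast
    qed (use lok in \<open>simp_all add: level_ok_def\<close>)
    also have "\<dots> \<le> sqrt c ^ l"
      using lok by (simp add: level_ok_def)
    finally show ?thesis .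
  qed
  then have "(\<Sum>l\<in>{1..L}. real (length (att l)) * eh) \<le> (\<Sum>l\<in>{1..L}. sqrt c ^ l)"
    by (rule sum_mono)
  also have "\<dots> \<le> (\<Sum>l. sqrt c ^ l)"
    using sc by (intro sum_le_suminf summable_geometric) auto
  also have "\<dots> = 1 / (1 - sqrt c)"
    using sc by (intro suminf_geometric) auto
  finally have "real (num_attention L att) * eh \<le> 1 / (1 - sqrt c)"
    by (simp only: of_nat_sum sum_distrib_right)
  then have "real (num_attention L att) \<le> (1 / (1 - sqrt c)) / eh"
    using eh by (simp only: pos_le_divide_eq)
  then show ?thesis by simp
qed

text \<open>Loops over the levels \<open>l + i\<close> are charged to the total number of attention
  nodes, which avoids a factor \<open>L\<close>. Levels beyond \<open>L\<close> contribute nothing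
  because \<open>attention_ok\<close> keeps them empty.\<close>

lemma num_attention_shift:
  assumes "attention_ok L h eh att"
  shows "(\<Sum>i\<leftarrow>[1..<n]. length (att (l + i))) \<le> num_attention L att"
proof -
  have "(\<Sum>i\<leftarrow>[1..<n]. length (att (l + i))) = (\<Sum>i\<in>{1..<n}. length (att (l + i)))"
    by (simp add: sum_list_distinct_conv_sum_set)
  also have "\<dots> = (\<Sum>k\<in>(+) l ` {1..<n}. length (att k))"
    by (subst sum.reindex) auto
  also have "\<dots> = (\<Sum>k\<in>(+) l ` {1..<n} \<inter> {1..L}. length (att k))"
    using assms by (intro sum.mono_neutral_right) (auto simp: attention_ok_def)
  also have "\<dots> \<le> num_attention L att"
    by (rule sum_mono2) auto
  finally show ?thesis .
qed

section \<open>Hitting tables and last-meeting probabilities\<close>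

definition hits_ok :: "(nat \<Rightarrow> 'v list) \<Rightarrow> 'v hit_table \<Rightarrow> bool" where
  "hits_ok att ht \<longleftrightarrow> (\<forall>l w. distinct (keys (ht l w)) \<and>
     (\<forall>(i, wi) \<in> set (keys (ht l w)). wi \<in> set (att (l + i))))"

text \<open>Passing to the absolute level \<open>l + i\<close> maps the keys of one table
  injectively to the attention nodes of all levels, where copies of a node on different levels count
  separately.\<close>

lemma hits_ok_length_keys:
  assumes att: "attention_ok L h eh att" and ht: "hits_ok att ht"
  shows "length (keys (ht l w)) \<le> num_attention L att"
proof -
  have "length (keys (ht l w)) = card (set (keys (ht l w)))"
    using ht by (simp add: hits_ok_def distinct_card)
  also have "\<dots> \<le> card (SIGMA k:{1..L}. set (att k))"
  proof (rule card_inj_on_le[where f = "\<lambda>(i, wi). (l + i, wi)"])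
    have "l + i \<in> {1..L}" if "wi \<in> set (att (l + i))" for i wi
      using att that unfolding attention_ok_def by (metis empty_iff list.set(1))
    then show "(\<lambda>(i, wi). (l + i, wi)) ` set (keys (ht l w)) \<subseteq> (SIGMA k:{1..L}. set (att k))"
      using ht unfolding hits_ok_def by fast
  qed (auto simp: inj_on_def)
  also have "\<dots> = num_attention L att"
    using att by (simp add: attention_ok_def distinct_card)
  finally show ?thesis .
qed

lemma hits_ok_update:
  assumes "hits_ok att ht" and "wi \<in> set (att (l + i))"
  shows "hits_ok att (update_hit l w (set_at (i, wi) x) ht)"
    and "hits_ok att (update_hit l w (add_at (i, wi) x) ht)"
  using assms unfolding hits_ok_def update_hit_def by simp_all

text \<open>On one level there are at most \<open>m\<close> nodes and at most \<open>m\<close>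
  recorded arcs, and every table has at most \<open>K\<close> keys. Node-key pairs and arc-key pairs
  cost two operations each; together they give the term \<open>4 * K * m\<close>.\<close>

lemma graph_hits_runs:
  assumes h: "push_state_ok c u L (h, g)" and att: "attention_ok L h eh att"
  defines "K \<equiv> num_attention L att"
  shows "runs_within (graph_hits A c L h g att) (1 + L * (3 + 2 * K + 2 * m + 4 * K * m)) (hits_ok att)"
proof -
  have arcs: "runs_within (for_each (g l w') (\<lambda>wa ht.
        charge (update_hit (l - 1) wa (add_at (Suc i, wi)
          (sqrt c / real (in_degree A wa) * val (ht l w') (i, wi))) ht)) ht)
        (1 + 2 * length (g l w')) (hits_ok att)"
    if "hits_ok att ht" and "wi \<in> set (att (l + i))" and "1 \<le> l" for l w' i wi ht
  proof -
    have "runs_within (for_each (g l w') (\<lambda>wa ht.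
        charge (update_hit (l - 1) wa (add_at (Suc i, wi)
          (sqrt c / real (in_degree A wa) * val (ht l w') (i, wi))) ht)) ht)
        (1 + (\<Sum>_\<leftarrow>g l w'. 1 + 1)) (hits_ok att)"
    proof (rule runs_within_for_each_inv)
      fix wa and ht :: "'v hit_table" assume "hits_ok att ht"
      then show "runs_within (charge (update_hit (l - 1) wa (add_at (Suc i, wi)
          (sqrt c / real (in_degree A wa) * val (ht l w') (i, wi))) ht)) 1 (hits_ok att)"
        \<comment> \<open>One level down, the distance grows by one:
          \<open>l - 1 + Suc i = l + i\<close> since \<open>1 \<le> l\<close>, so the key still
          denotes the same attention node.\<close>
        by (intro runs_within_charge hits_ok_update) (use that in simp_all)
    qed (use that in simp)
    then show ?thesis by (simp add: sum_list_triv mult_2)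
  qed
  have node: "runs_within (for_each (keys (ht l w')) (\<lambda>(i, wi) ht.
      for_each (g l w') (\<lambda>wa ht.
        charge (update_hit (l - 1) wa (add_at (Suc i, wi)
          (sqrt c / real (in_degree A wa) * val (ht l w') (i, wi))) ht)) ht) ht)
      (1 + K * (2 + 2 * length (g l w'))) (hits_ok att)"
    if ht: "hits_ok att ht" and l: "1 \<le> l" for l w' ht
  proof -
    have "runs_within (for_each (keys (ht l w')) (\<lambda>(i, wi) ht.
      for_each (g l w') (\<lambda>wa ht.
        charge (update_hit (l - 1) wa (add_at (Suc i, wi)
          (sqrt c / real (in_degree A wa) * val (ht l w') (i, wi))) ht)) ht) ht)
      (1 + (\<Sum>_\<leftarrow>keys (ht l w'). 1 + (1 + 2 * length (g l w')))) (hits_ok att)"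
    proof (rule runs_within_for_each_inv)
      \<comment> \<open>The key list was read at loop entry, from \<open>ht\<close>; the body runs
        on the current table \<open>ht'\<close>. Validity of a key refers only to
        \<open>att\<close>, so it survives the change of table.\<close>
      fix k :: "nat \<times> 'v" and ht'
      assume k: "k \<in> set (keys (ht l w'))" and "hits_ok att ht'"
      obtain i wi where k_eq: "k = (i, wi)" by force
      then have wi: "wi \<in> set (att (l + i))"
        using k ht unfolding hits_ok_def by fast
      show "runs_within ((\<lambda>(i, wi) ht. for_each (g l w') (\<lambda>wa ht.
        charge (update_hit (l - 1) wa (add_at (Suc i, wi)
          (sqrt c / real (in_degree A wa) * val (ht l w') (i, wi))) ht)) ht) k ht')
          (1 + 2 * length (g l w')) (hits_ok att)"
        unfolding k_eq prod.case by (rule arcs[OF \<open>hits_ok att ht'\<close> wi l])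
    qed (fact ht)
    then show ?thesis
    proof (rule runs_within_mono)
      show "1 + (\<Sum>_\<leftarrow>keys (ht l w'). 1 + (1 + 2 * length (g l w'))) \<le> 1 + K * (2 + 2 * length (g l w'))"
        using mult_right_mono[OF hits_ok_length_keys[OF att ht, of l w'], of "2 + 2 * length (g l w')"]
        unfolding K_def sum_list_triv by simp
    qed
  qed
  have level: "runs_within (do {
       ht \<leftarrow> for_each (att l) (\<lambda>w ht. charge (update_hit l w (set_at (0, w) 1) ht)) ht;
       for_each (keys (h l)) (\<lambda>w' ht.
         for_each (keys (ht l w')) (\<lambda>(i, wi) ht.
           for_each (g l w') (\<lambda>wa ht.
             charge (update_hit (l - 1) wa
               (add_at (Suc i, wi)
                  (sqrt c / real (in_degree A wa) * val (ht l w') (i, wi))) ht)) ht) ht) ht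
     }) (2 + 2 * K + 2 * m + 4 * K * m) (hits_ok att)"
    if ht: "hits_ok att ht" and l: "l \<in> set (rev [2..<Suc L])" for l ht
  proof -
    have lok: "level_ok c l (h l) (g l)" and l1: "1 \<le> l"
      using h l by (auto simp: push_state_ok_def)
    have "runs_within (for_each (att l) (\<lambda>w ht. charge (update_hit l w (set_at (0, w) 1) ht)) ht)
        (1 + (\<Sum>_\<leftarrow>att l. 1 + 1)) (hits_ok att)"
    proof (rule runs_within_for_each_inv)
      fix w and ht :: "'v hit_table" assume "hits_ok att ht" "w \<in> set (att l)"
      then show "runs_within (charge (update_hit l w (set_at (0, w) 1) ht)) 1 (hits_ok att)"
        by (intro runs_within_charge hits_ok_update) simp_all
    qed (fact ht)
    from runs_within_bind[OF this runs_within_for_each_inv[where I = "hits_ok att"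
        and cost = "\<lambda>w'. 1 + K * (2 + 2 * length (g l w'))" and xs = "keys (h l)", OF _ node[OF _ l1]]]
    show ?thesis
    proof (rule runs_within_mono)
      have "length (att l) \<le> K"
        unfolding K_def using l by (intro member_le_sum) auto
      moreover have "length (keys (h l)) \<le> m"
        using level_ok_length_keys[OF lok] l1 by simp
      moreover have "(\<Sum>w'\<leftarrow>keys (h l). length (g l w')) \<le> m"
      proof -
        have "(\<Sum>w'\<leftarrow>keys (h l). length (g l w')) = (\<Sum>w'\<in>set (keys (h l)). length (g l w'))"
          using lok by (simp add: level_ok_def sum_list_distinct_conv_sum_set)
        also have "\<dots> \<le> (\<Sum>w'\<in>pverts G. length (g l w'))"
          using lok by (intro sum_mono2) (auto simp: level_ok_def)
        also have "\<dots> \<le> m"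
          using lok by (simp add: level_ok_def)
        finally show ?thesis .
      qed
      moreover have "(\<Sum>w'\<leftarrow>xs. 1 + (1 + K * (2 + 2 * length (g l w'))))
          = 2 * length xs + 2 * (K * length xs) + 2 * (K * (\<Sum>w'\<leftarrow>xs. length (g l w')))" for xs
        by (induction xs) (simp_all add: algebra_simps)
      ultimately have "(\<Sum>w'\<leftarrow>keys (h l). 1 + (1 + K * (2 + 2 * length (g l w'))))
          \<le> 2 * m + 2 * (K * m) + 2 * (K * m)"
        by (simp only:) (intro add_mono mult_left_mono; simp)
      with \<open>length (att l) \<le> K\<close> show "(1 + (\<Sum>_\<leftarrow>att l. 1 + 1)) +
          (1 + (\<Sum>w'\<leftarrow>keys (h l). 1 + (1 + K * (2 + 2 * length (g l w')))))
          \<le> 2 + 2 * K + 2 * m + 4 * K * m"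
        by (simp add: sum_list_triv)
    qed
  qed
  have "runs_within (graph_hits A c L h g att)
      (1 + (\<Sum>_\<leftarrow>rev [2..<Suc L]. 1 + (2 + 2 * K + 2 * m + 4 * K * m))) (hits_ok att)"
    unfolding graph_hits_def
    by (rule runs_within_for_each_inv) (use level in \<open>auto simp: hits_ok_def\<close>)
  then show ?thesis
  proof (rule runs_within_mono)
    have "length (rev [2..<Suc L]) * (1 + (2 + 2 * K + 2 * m + 4 * K * m)) \<le> L * (3 + 2 * K + 2 * m + 4 * K * m)"
      by (rule mult_mono) auto
    then show "1 + (\<Sum>_\<leftarrow>rev [2..<Suc L]. 1 + (2 + 2 * K + 2 * m + 4 * K * m))
       \<le> 1 + L * (3 + 2 * K + 2 * m + 4 * K * m)"
      by (simp only: sum_list_triv of_nat_id add_le_cancel_left)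
  qed
qed

text \<open>Every stored \<rho> belongs to an attention node, and different distances j belong to
  different levels. The whole inner double loop therefore visits at most \<open>K\<close> stored
  terms, plus two operations per level, and it is run for at most \<open>K\<close> targets
  \<open>wi\<close>.\<close>

lemma last_meeting_runs:
  assumes att: "attention_ok L h eh att"
  defines "K \<equiv> num_attention L att"
  shows "runs_within (last_meeting L att ht l w) (4 + 4 * L + 2 * K + K * (4 + 2 * L + 2 * K)) (\<lambda>_. True)"
proof -
  define rho_ok :: "(nat \<Rightarrow> ('v, real) sparse) \<Rightarrow> bool" where
    "rho_ok \<rho> \<longleftrightarrow> (\<forall>i. distinct (keys (\<rho> i)) \<and> set (keys (\<rho> i)) \<subseteq> set (att (l + i)))" for \<rho>
  have shift: "(\<Sum>i\<leftarrow>[1..<n]. length (att (l + i))) \<le> K" for n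
    unfolding K_def by (rule num_attention_shift[OF att])
  have len: "length (keys (\<rho> i)) \<le> length (att (l + i))" if "rho_ok \<rho>" for \<rho> i
  proof -
    have "card (set (keys (\<rho> i))) \<le> card (set (att (l + i)))"
      using that by (intro card_mono) (auto simp: rho_ok_def)
    then show ?thesis
      using that att by (simp add: rho_ok_def attention_ok_def distinct_card)
  qed
  \<comment> \<open>The part \<open>2 * n\<close> pays for levels without stored terms. This bound
    serves both the subtraction loop and the final summation of \<gamma>.\<close>
  have rho_sum: "(\<Sum>i\<leftarrow>[1..<n]. 1 + (1 + (\<Sum>_\<leftarrow>keys (\<rho> i). 1 + 1))) \<le> 2 * n + 2 * K"
    if "rho_ok \<rho>" for \<rho> and n :: nat
  proof -
    have "(\<Sum>i\<leftarrow>[1..<n]. 1 + (1 + (\<Sum>_\<leftarrow>keys (\<rho> i). 1 + 1)))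
        \<le> (\<Sum>i\<leftarrow>[1..<n]. 2 + 2 * length (att (l + i)))"
      using len[OF that] by (intro sum_list_mono) (simp add: sum_list_triv mult_2 add_mono)
    also have "\<dots> = 2 * length [1..<n] + 2 * (\<Sum>i\<leftarrow>[1..<n]. length (att (l + i)))"
      by (simp only: sum_list_addf sum_list_const_mult sum_list_triv) simp
    also have "\<dots> \<le> 2 * n + 2 * K"
      using shift[of n] by (intro add_mono mult_left_mono) auto
    finally show ?thesis .
  qed
  have entry: "runs_within (do {
         q \<leftarrow> charge ((val (ht l w) (i, wi))\<^sup>2);
         q \<leftarrow> for_each [1..<i] (\<lambda>j q.
           for_each (keys (\<rho> j)) (\<lambda>wj q.
             charge (if val (ht (l + j) wj) (i - j, wi) \<noteq> 0
                     then q - val (\<rho> j) wj * (val (ht (l + j) wj) (i - j, wi))\<^sup>2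
                     else q)) q) q;
         charge (if q \<noteq> 0 then \<rho>(i := set_at wi q (\<rho> i)) else \<rho>)
       }) (3 + 2 * L + 2 * K) rho_ok"
    if \<rho>: "rho_ok \<rho>" and wi: "wi \<in> set (att (l + i))" and i: "i \<in> set [1..<Suc (L - l)]" for \<rho> wi i
  proof -
    have "runs_within (for_each [1..<i] (\<lambda>j q.
           for_each (keys (\<rho> j)) (\<lambda>wj q.
             charge (if val (ht (l + j) wj) (i - j, wi) \<noteq> 0
                     then q - val (\<rho> j) wj * (val (ht (l + j) wj) (i - j, wi))\<^sup>2
                     else q)) q) q)
        (1 + (\<Sum>j\<leftarrow>[1..<i]. 1 + (1 + (\<Sum>_\<leftarrow>keys (\<rho> j). 1 + 1)))) (\<lambda>_. True)" for q
      by (intro runs_within_for_each_inv runs_within_charge TrueI)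
    moreover have "runs_within (charge (if q \<noteq> 0 then \<rho>(i := set_at wi q (\<rho> i)) else \<rho>)) 1 rho_ok" for q
      using \<rho> wi by (intro runs_within_charge) (simp add: rho_ok_def)
    ultimately have "runs_within (do {
         q \<leftarrow> charge ((val (ht l w) (i, wi))\<^sup>2);
         q \<leftarrow> for_each [1..<i] (\<lambda>j q.
           for_each (keys (\<rho> j)) (\<lambda>wj q.
             charge (if val (ht (l + j) wj) (i - j, wi) \<noteq> 0
                     then q - val (\<rho> j) wj * (val (ht (l + j) wj) (i - j, wi))\<^sup>2
                     else q)) q) q;
         charge (if q \<noteq> 0 then \<rho>(i := set_at wi q (\<rho> i)) else \<rho>)
       }) (1 + ((1 + (\<Sum>j\<leftarrow>[1..<i]. 1 + (1 + (\<Sum>_\<leftarrow>keys (\<rho> j). 1 + 1)))) + 1)) rho_ok"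
      by (intro runs_within_charge_bind runs_within_bind)
    then show ?thesis
    proof (rule runs_within_mono)
      have "i \<le> L" using i by auto
      then show "1 + ((1 + (\<Sum>j\<leftarrow>[1..<i]. 1 + (1 + (\<Sum>_\<leftarrow>keys (\<rho> j). 1 + 1)))) + 1) \<le> 3 + 2 * L + 2 * K"
        using rho_sum[OF \<rho>, of i] by linarith
    qed
  qed
  have rho: "runs_within (for_each [1..<Suc (L - l)] (\<lambda>i \<rho>.
       for_each (att (l + i)) (\<lambda>wi \<rho>. do {
         q \<leftarrow> charge ((val (ht l w) (i, wi))\<^sup>2);
         q \<leftarrow> for_each [1..<i] (\<lambda>j q.
           for_each (keys (\<rho> j)) (\<lambda>wj q.
             charge (if val (ht (l + j) wj) (i - j, wi) \<noteq> 0
                     then q - val (\<rho> j) wj * (val (ht (l + j) wj) (i - j, wi))\<^sup>2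
                     else q)) q) q;
         charge (if q \<noteq> 0 then \<rho>(i := set_at wi q (\<rho> i)) else \<rho>)
       }) \<rho>) (\<lambda>_. empty_sparse))
       (1 + (\<Sum>i\<leftarrow>[1..<Suc (L - l)]. 1 + (1 + (\<Sum>_\<leftarrow>att (l + i). 1 + (3 + 2 * L + 2 * K))))) rho_ok"
    by (intro runs_within_for_each_inv entry) (simp_all add: rho_ok_def)
  have "runs_within (last_meeting L att ht l w)
      ((1 + (\<Sum>i\<leftarrow>[1..<Suc (L - l)]. 1 + (1 + (\<Sum>_\<leftarrow>att (l + i). 1 + (3 + 2 * L + 2 * K)))))
        + (3 + 2 * L + 2 * K)) (\<lambda>_. True)"
    unfolding last_meeting_def
  proof (rule runs_within_bind[OF rho])
    fix \<rho> assume \<rho>: "rho_ok \<rho>"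
    have "runs_within (for_each [1..<Suc (L - l)] (\<lambda>i \<gamma>.
       for_each (keys (\<rho> i)) (\<lambda>wi \<gamma>. charge (\<gamma> - val (\<rho> i) wi)) \<gamma>) 1)
       (1 + (\<Sum>j\<leftarrow>[1..<Suc (L - l)]. 1 + (1 + (\<Sum>_\<leftarrow>keys (\<rho> j). 1 + 1)))) (\<lambda>_. True)"
      by (intro runs_within_for_each_inv runs_within_charge TrueI)
    then show "runs_within (for_each [1..<Suc (L - l)] (\<lambda>i \<gamma>.
       for_each (keys (\<rho> i)) (\<lambda>wi \<gamma>. charge (\<gamma> - val (\<rho> i) wi)) \<gamma>) 1) (3 + 2 * L + 2 * K) (\<lambda>_. True)"
    proof (rule runs_within_mono)
      define n where "n = Suc (L - l)"
      have "n \<le> Suc L" by (simp add: n_def)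
      then show "1 + (\<Sum>j\<leftarrow>[1..<Suc (L - l)]. 1 + (1 + (\<Sum>_\<leftarrow>keys (\<rho> j). 1 + 1))) \<le> 3 + 2 * L + 2 * K"
        using rho_sum[OF \<rho>, of n] unfolding n_def[symmetric] by linarith
    qed simp
  qed
  then show ?thesis
  proof (rule runs_within_mono)
    define n where "n = Suc (L - l)"
    have "(\<Sum>i\<leftarrow>[1..<n]. 1 + (1 + (\<Sum>_\<leftarrow>att (l + i). 1 + (3 + 2 * L + 2 * K))))
        = (\<Sum>i\<leftarrow>[1..<n]. 2 + (4 + 2 * L + 2 * K) * length (att (l + i)))"
      by (intro arg_cong[where f = sum_list] map_cong refl) (simp add: sum_list_triv)
    also have "\<dots> = 2 * length [1..<n] + (4 + 2 * L + 2 * K) * (\<Sum>i\<leftarrow>[1..<n]. length (att (l + i)))"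
      by (simp only: sum_list_addf sum_list_const_mult sum_list_triv) simp
    also have "\<dots> \<le> 2 * L + (4 + 2 * L + 2 * K) * K"
      using shift[of n] by (intro add_mono mult_left_mono) (auto simp: n_def)
    finally have "(\<Sum>i\<leftarrow>[1..<n]. 1 + (1 + (\<Sum>_\<leftarrow>att (l + i). 1 + (3 + 2 * L + 2 * K))))
        \<le> 2 * L + K * (4 + 2 * L + 2 * K)"
      by (simp only: mult.commute)
    then show "(1 + (\<Sum>i\<leftarrow>[1..<Suc (L - l)]. 1 + (1 + (\<Sum>_\<leftarrow>att (l + i). 1 + (3 + 2 * L + 2 * K)))))
        + (3 + 2 * L + 2 * K) \<le> 4 + 4 * L + 2 * K + K * (4 + 2 * L + 2 * K)"
      unfolding n_def[symmetric] by linarith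
  qed
qed

section \<open>Residues, reverse push and output\<close>

definition residues_ok :: "(nat \<Rightarrow> ('v, real) sparse) \<Rightarrow> bool" where
  "residues_ok r \<longleftrightarrow> (\<forall>l. distinct (keys (r l)) \<and> set (keys (r l)) \<subseteq> set (node_list A))"

lemma residues_ok_set_at:
  assumes "residues_ok r" and "v \<in> set (node_list A)"
  shows "residues_ok (r(l := set_at v x (r l)))"
  using assms by (simp add: residues_ok_def)

text \<open>The last-meeting recursion is run once for each of the \<open>K\<close> attention nodes;
  this yields the cubic term \<open>2 * K ^ 3\<close>, the origin of the summand 1/\<epsilon>^3 in
  the theorem.\<close>

lemma initial_residues_runs:
  assumes h: "push_state_ok c u L (h, g)" and att: "attention_ok L h eh att"
  defines "K \<equiv> num_attention L att"
  shows "runs_within (initial_residues L h att ht)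
    (1 + 2 * L + K * (6 + 4 * L + 2 * K + K * (4 + 2 * L + 2 * K))) residues_ok"
proof -
  define T where "T = 4 + 4 * L + 2 * K + K * (4 + 2 * L + 2 * K)"
  have "runs_within (initial_residues L h att ht)
    (1 + (\<Sum>l\<leftarrow>[1..<Suc L]. 1 + (1 + (\<Sum>_\<leftarrow>att l. 1 + (T + 1))))) residues_ok"
    unfolding initial_residues_def
  proof (intro runs_within_for_each_inv)
    show "residues_ok (\<lambda>_. empty_sparse)"
      by (simp add: residues_ok_def)
    fix l w r
    assume l: "l \<in> set [1..<Suc L]" and w: "w \<in> set (att l)" and r: "residues_ok r"
    have "set (att l) \<subseteq> set (keys (h l))"
      using att by (simp add: attention_ok_def)
    also have "\<dots> \<subseteq> fst ` parcs G"
    proof -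
      have "l \<le> L" "l > 0" using l by auto
      with h have "level_ok c l (h l) (g l)"
        by (simp add: push_state_ok_def)
      then show ?thesis
        using \<open>l > 0\<close> by (simp add: level_ok_def)
    qed
    also have "\<dots> \<subseteq> set (node_list A)"
      by (simp add: node_list)
    finally have w': "w \<in> set (node_list A)"
      using w by auto
    show "runs_within (do {
         \<gamma> \<leftarrow> last_meeting L att ht l w;
         charge (r(l := set_at w (val (h l) w * \<gamma>) (r l)))
       }) (T + 1) residues_ok"
      unfolding T_def K_def
      by (intro runs_within_bind[OF last_meeting_runs[OF att]] runs_within_charge residues_ok_set_at r w')
  qed
  then show ?thesis
  proof (rule runs_within_mono)
    \<comment> \<open>The index is written \<open>0 + l\<close> so that
      \<open>num_attention_shift\<close> applies with shift 0.\<close>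
    have "(\<Sum>l\<leftarrow>[1..<Suc L]. 1 + (1 + (\<Sum>_\<leftarrow>att l. 1 + (T + 1))))
        = (\<Sum>l\<leftarrow>[1..<Suc L]. 2 + (2 + T) * length (att (0 + l)))"
      by (intro arg_cong[where f = sum_list] map_cong refl) (simp add: sum_list_triv)
    also have "\<dots> = 2 * length [1..<Suc L] + (2 + T) * (\<Sum>l\<leftarrow>[1..<Suc L]. length (att (0 + l)))"
      by (simp only: sum_list_addf sum_list_const_mult sum_list_triv) simp
    also have "\<dots> \<le> 2 * L + (2 + T) * K"
      unfolding K_def by (intro add_mono mult_left_mono num_attention_shift[OF att]) auto
    finally show "1 + (\<Sum>l\<leftarrow>[1..<Suc L]. 1 + (1 + (\<Sum>_\<leftarrow>att l. 1 + (T + 1))))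
      \<le> 1 + 2 * L + K * (6 + 4 * L + 2 * K + K * (4 + 2 * L + 2 * K))"
      unfolding T_def by (simp add: algebra_simps)
  qed
qed

text \<open>Initial residues sit on tails of arcs, pushed ones on heads; \<open>node_list A\<close>
  contains both, so a level has up to \<open>2 * m\<close> keys. The estimate lets every key pass
  the threshold test: two operations for each key and two for each of at most \<open>m\<close> arcs
  give \<open>6 * m\<close>.\<close>

lemma reverse_push_runs:
  assumes "residues_ok r"
  shows "runs_within (reverse_push A c eh L r) (2 + 4 * m + L * (2 + 6 * m)) (\<lambda>_. True)"
proof -
  let ?ok = "\<lambda>(r, s :: 'v \<Rightarrow> real). residues_ok r"
  let ?push = "\<lambda>l v' (r, s :: 'v \<Rightarrow> real).
         if sqrt c * val (r l) v' \<ge> eh then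
           for_each (out_list A v') (\<lambda>v (r, s).
             let x = sqrt c * val (r l) v' / real (in_degree A v)
             in charge (if l > 1 then (r(l - 1 := add_at v x (r (l - 1))), s)
                        else (r, s(v := s v + x)))) (r, s)
         else charge (r, s)"
  have node: "runs_within (?push l v' s) (1 + 2 * length (out_list A v')) ?ok"
    if s: "?ok s" and v': "v' \<in> set (node_list A)" for l v' s
  proof -
    have v'V: "v' \<in> pverts G"
      using v' node_list arc_ends by auto
    have "runs_within (for_each (out_list A v') (\<lambda>v (r, s).
             let x = sqrt c * val (r l) v' / real (in_degree A v)
             in charge (if l > 1 then (r(l - 1 := add_at v x (r (l - 1))), s)
                        else (r, s(v := s v + x)))) s)
             (1 + (\<Sum>_\<leftarrow>out_list A v'. 1 + 1)) ?ok"
    proof (rule runs_within_for_each_inv)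
      fix v and s :: "(nat \<Rightarrow> ('v, real) sparse) \<times> ('v \<Rightarrow> real)"
      assume "v \<in> set (out_list A v')" and "?ok s"
      moreover from this(1) have "v \<in> set (node_list A)"
        using out_list[OF v'V] node_list by force
      ultimately show "runs_within ((\<lambda>(r, s).
             let x = sqrt c * val (r l) v' / real (in_degree A v)
             in charge (if l > 1 then (r(l - 1 := add_at v x (r (l - 1))), s)
                        else (r, s(v := s v + x)))) s) 1 ?ok"
        by (cases s) (simp add: Let_def add_at_def residues_ok_set_at
            runs_within_charge[unfolded One_nat_def])
    qed (fact s)
    then have "runs_within (for_each (out_list A v') (\<lambda>v (r, s).
             let x = sqrt c * val (r l) v' / real (in_degree A v)
             in charge (if l > 1 then (r(l - 1 := add_at v x (r (l - 1))), s)
                        else (r, s(v := s v + x)))) s) (1 + 2 * length (out_list A v')) ?ok"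
      by (simp add: sum_list_triv mult_2)
    moreover have "runs_within (charge s) (1 + 2 * length (out_list A v')) ?ok"
      by (rule runs_within_mono[OF runs_within_charge[of ?ok, OF s]]) simp_all
    ultimately show ?thesis by (cases s) simp
  qed
  have level: "runs_within (for_each (keys (r l)) (?push l) (r, s)) (1 + 6 * m) ?ok"
    if r: "residues_ok r" for l r s
  proof -
    have "runs_within (for_each (keys (r l)) (?push l) (r, s))
        (1 + (\<Sum>v'\<leftarrow>keys (r l). 1 + (1 + 2 * length (out_list A v')))) ?ok"
    proof (rule runs_within_for_each_inv)
      fix v' s' assume v': "v' \<in> set (keys (r l))" and s': "?ok s'"
      then show "runs_within (?push l v' s') (1 + 2 * length (out_list A v')) ?ok"
        using r by (intro node) (auto simp: residues_ok_def)
    qed (use r in simp)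
    then show ?thesis
    proof (rule runs_within_mono)
      have nodes: "set (keys (r l)) \<subseteq> set (node_list A)" and dist: "distinct (keys (r l))"
        using r by (simp_all add: residues_ok_def)
      have "length (keys (r l)) \<le> length (node_list A)"
        using card_mono[OF _ nodes] dist node_list(1) by (simp add: distinct_card)
      then have "length (keys (r l)) \<le> 2 * m"
        using length_node_list by linarith
      moreover have "(\<Sum>v'\<leftarrow>keys (r l). length (out_list A v')) \<le> m"
      proof -
        have "set (keys (r l)) \<subseteq> pverts G"
          using nodes node_list arc_ends by auto
        then show ?thesis
          using dist sum_out_degree by (simp add: sum_list_distinct_conv_sum_set)
      qed
      moreover have "(\<Sum>v'\<leftarrow>xs. 1 + (1 + 2 * length (out_list A v')))
          = 2 * length xs + 2 * (\<Sum>v'\<leftarrow>xs. length (out_list A v'))" for xs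
        by (induction xs) simp_all
      ultimately show "1 + (\<Sum>v'\<leftarrow>keys (r l). 1 + (1 + 2 * length (out_list A v'))) \<le> 1 + 6 * m"
        by presburger
    qed simp
  qed
  have "runs_within (reverse_push A c eh L r)
      ((1 + (\<Sum>_\<leftarrow>node_list A. 1 + 1)) + ((1 + (\<Sum>_\<leftarrow>rev [1..<Suc L]. 1 + (1 + 6 * m))) + 0)) (\<lambda>_. True)"
    unfolding reverse_push_def
  proof (rule runs_within_bind[OF runs_within_for_each_inv[where I = "\<lambda>_. True"]])
    fix s :: "'v \<Rightarrow> real"
    have "runs_within (for_each (rev [1..<Suc L]) (\<lambda>l (r, s). for_each (keys (r l)) (?push l) (r, s)) (r, s))
       (1 + (\<Sum>_\<leftarrow>rev [1..<Suc L]. 1 + (1 + 6 * m))) ?ok"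
      by (rule runs_within_for_each_inv) (use assms level in auto)
    then show "runs_within (do {
        (r, s) \<leftarrow> for_each (rev [1..<Suc L]) (\<lambda>l (r, s). for_each (keys (r l)) (?push l) (r, s)) (r, s);
        ret s
      }) ((1 + (\<Sum>_\<leftarrow>rev [1..<Suc L]. 1 + (1 + 6 * m))) + 0) (\<lambda>_. True)"
      by (rule runs_within_bind) (auto intro: runs_within_ret)
  qed (auto intro: runs_within_charge[unfolded One_nat_def])
  then show ?thesis
  proof (rule runs_within_mono)
    show "(1 + (\<Sum>_\<leftarrow>node_list A. 1 + 1)) + ((1 + (\<Sum>_\<leftarrow>rev [1..<Suc L]. 1 + (1 + 6 * m))) + 0)
      \<le> 2 + 4 * m + L * (2 + 6 * m)"
      using length_node_list by (simp add: sum_list_triv del: upt_Suc)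
  qed simp
qed

lemma output_scores_runs: "runs_within (output_scores A u s) (3 + 4 * m) (\<lambda>_. True)"
proof -
  have "runs_within (output_scores A u s) (1 + (1 + (1 + (\<Sum>_\<leftarrow>node_list A. 1 + 1)))) (\<lambda>_. True)"
    unfolding output_scores_def
    by (intro runs_within_charge_bind runs_within_for_each_inv runs_within_charge TrueI)
  then show ?thesis
    by (rule runs_within_mono) (use length_node_list in \<open>simp_all add: sum_list_triv\<close>)
qed

section \<open>Assembly of the deterministic stages\<close>

definition stages_cost :: "nat \<Rightarrow> nat \<Rightarrow> nat" where
  "stages_cost L K =
     (1 + L * (4 + 5 * m)) + ((1 + L * (2 + 2 * m)) + ((1 + L * (3 + 2 * K + 2 * m + 4 * K * m)) +
     ((1 + 2 * L + K * (6 + 4 * L + 2 * K + K * (4 + 2 * L + 2 * K))) +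
     ((2 + 4 * m + L * (2 + 6 * m)) + (3 + 4 * m)))))"

lemma stages_cost_mono:
  assumes "L \<le> L'" and "K \<le> K'"
  shows "stages_cost L K \<le> stages_cost L' K'"
  unfolding stages_cost_def by (intro add_mono mult_mono order_refl assms) auto

text \<open>The number of attention nodes is an integer below \<open>K + 1\<close>, hence at most
  \<open>K\<close>; this form of the assumption allows \<open>K\<close> to be the floor of the
  bound. The cost of scanning \<open>H\<close> stays separate because \<open>H\<close> is
  random.\<close>

lemma stages_run:
  assumes u: "u \<in> pverts G" and c: "0 < c" "c < 1" and eh: "0 < eh"
    and K: "1 / ((1 - sqrt c) * eh) < real K + 1"
  shows "runs_within (do {
       L \<leftarrow> detect_level H thr Lmax;
       (h, g) \<leftarrow> source_push A c u L;
       att \<leftarrow> attention_nodes eh L h;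
       ht \<leftarrow> graph_hits A c L h g att;
       r \<leftarrow> initial_residues L h att ht;
       s \<leftarrow> reverse_push A c eh L r;
       output_scores A u s
     }) (2 * length (keys H) + 2 + stages_cost Lmax K) (\<lambda>_. True)"
proof (rule runs_within_bind[OF detect_level_runs])
  fix L assume L: "L \<le> Lmax"
  let ?attend = "\<lambda>h g. do {
       att \<leftarrow> attention_nodes eh L h;
       ht \<leftarrow> graph_hits A c L h g att;
       r \<leftarrow> initial_residues L h att ht;
       s \<leftarrow> reverse_push A c eh L r;
       output_scores A u s
     }"
  have push: "runs_within (?attend h g)
      ((1 + L * (2 + 2 * m)) + ((1 + L * (3 + 2 * K + 2 * m + 4 * K * m)) +
     ((1 + 2 * L + K * (6 + 4 * L + 2 * K + K * (4 + 2 * L + 2 * K))) +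
     ((2 + 4 * m + L * (2 + 6 * m)) + (3 + 4 * m))))) (\<lambda>_. True)"
    if h: "push_state_ok c u L (h, g)" for h g
  proof (rule runs_within_bind[OF attention_nodes_runs[OF h]])
    fix att assume att: "attention_ok L h eh att"
    have "real (num_attention L att) < real K + 1"
      using num_attention_bound[OF h att c eh] K by linarith
    then have le_K: "num_attention L att \<le> K" by linarith
    show "runs_within (do {
       ht \<leftarrow> graph_hits A c L h g att;
       r \<leftarrow> initial_residues L h att ht;
       s \<leftarrow> reverse_push A c eh L r;
       output_scores A u s
     }) ((1 + L * (3 + 2 * K + 2 * m + 4 * K * m)) +
     ((1 + 2 * L + K * (6 + 4 * L + 2 * K + K * (4 + 2 * L + 2 * K))) +
     ((2 + 4 * m + L * (2 + 6 * m)) + (3 + 4 * m)))) (\<lambda>_. True)"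
      by (rule runs_within_bind[OF runs_within_mono[OF graph_hits_runs[OF h att]]],
          (intro add_mono mult_mono order_refl le_K; simp), assumption,
          rule runs_within_bind[OF runs_within_mono[OF initial_residues_runs[OF h att]]],
          (intro add_mono mult_mono order_refl le_K; simp), assumption,
          rule runs_within_bind[OF reverse_push_runs], assumption,
          rule output_scores_runs)
  qed
  have "runs_within (do {(h, g) \<leftarrow> source_push A c u L; ?attend h g}) (stages_cost L K) (\<lambda>_. True)"
    \<comment> \<open>The nesting of the summands follows the nesting of the binds, so each bind
      splits off one stage.\<close>
    unfolding stages_cost_def
  proof (rule runs_within_bind[OF source_push_runs[OF u c]], goal_cases)
    case (1 s)
    then show ?case
      using push[of "fst s" "snd s"] unfolding split_beta prod.collapse by blast
  qed
  then show "runs_within (do {(h, g) \<leftarrow> source_push A c u L; ?attend h g}) (stages_cost Lmax K) (\<lambda>_. True)"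
    by (rule runs_within_mono) (simp_all add: stages_cost_mono L)
qed

end

section \<open>Expected costs of random computations\<close>

text \<open>A cost transformer in the style of weakest preconditions: \<Phi> is the expected cost of
  what runs after \<open>p\<close>, so sequential composition becomes nesting. The cap N is also the
  price of non-termination; for N = \<top> the cap disappears and a diverging run costs
  \<infinity>.\<close>

definition truncated_cost :: "ennreal \<Rightarrow> ('a \<Rightarrow> ennreal) \<Rightarrow> 'a rand_timed \<Rightarrow> ennreal" where
  "truncated_cost N \<Phi> p =
     (\<integral>\<^sup>+ z. (case z of None \<Rightarrow> N | Some (x, t) \<Rightarrow> min N (of_nat t + \<Phi> x)) \<partial>measure_pmf p)"

abbreviation expected_cost :: "('a \<Rightarrow> ennreal) \<Rightarrow> 'a rand_timed \<Rightarrow> ennreal" where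
  "expected_cost \<equiv> truncated_cost \<top>"

lemma expected_time_eq: "expected_time p = expected_cost (\<lambda>_. 0) p"
  unfolding expected_time_def truncated_cost_def
  by (intro nn_integral_cong) (auto split: option.splits simp: ennreal_of_nat_eq_real_of_nat)

lemma truncated_cost_mono:
  assumes "\<And>x. \<Phi> x \<le> \<Psi> x"
  shows "truncated_cost N \<Phi> p \<le> truncated_cost N \<Psi> p"
  unfolding truncated_cost_def
  by (intro nn_integral_mono) (auto split: option.splits intro!: min.mono add_left_mono assms simp del: min.bounded_iff)

lemma truncated_cost_le_expected_cost: "truncated_cost N \<Phi> p \<le> expected_cost \<Phi> p"
  unfolding truncated_cost_def
  by (intro nn_integral_mono) (auto split: option.splits)

lemma truncated_cost_le_bound: "truncated_cost N \<Phi> p \<le> N"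
proof -
  have "truncated_cost N \<Phi> p \<le> (\<integral>\<^sup>+ z. N \<partial>measure_pmf p)"
    unfolding truncated_cost_def
    by (intro nn_integral_mono) (auto split: option.splits)
  then show ?thesis by simp
qed

lemma expected_cost_add_const:
  "expected_cost (\<lambda>x. \<Phi> x + k) p \<le> expected_cost \<Phi> p + k"
proof -
  have "expected_cost (\<lambda>x. \<Phi> x + k) p
      \<le> (\<integral>\<^sup>+ z. (case z of None \<Rightarrow> \<top> | Some (x, t) \<Rightarrow> of_nat t + \<Phi> x) + k \<partial>measure_pmf p)"
    unfolding truncated_cost_def
    by (intro nn_integral_mono) (auto split: option.splits simp: add.assoc)
  also have "\<dots> = expected_cost \<Phi> p + k"
    unfolding truncated_cost_def by (subst nn_integral_add) (auto cong: option.case_cong)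
  finally show ?thesis .
qed

text \<open>Since \<open>min N (t + a) \<le> t + min N a\<close>, the time of \<open>p\<close> can
  leave the minimum while the continuation keeps the cap. This is the shape needed for unrolling a
  walk, whose recursive call is the continuation of terminating steps.\<close>

lemma truncated_cost_bind_le:
  "truncated_cost N \<Phi> (bind_rand p f) \<le> expected_cost (\<lambda>x. truncated_cost N \<Phi> (f x)) p"
proof -
  let ?\<phi> = "\<lambda>z. case z of None \<Rightarrow> N | Some (x, t) \<Rightarrow> min N (of_nat t + \<Phi> x)"
  have "truncated_cost N \<Phi> (bind_rand p f) =
     (\<integral>\<^sup>+ z. (\<integral>\<^sup>+ w. ?\<phi> w \<partial>measure_pmf (case z of None \<Rightarrow> return_pmf None
        | Some (x, t) \<Rightarrow> map_spmf (\<lambda>(y, t'). (y, t + t')) (f x))) \<partial>measure_pmf p)"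
    unfolding truncated_cost_def bind_rand_def bind_spmf_def by simp
  also have "\<dots> \<le> (\<integral>\<^sup>+ z. (case z of None \<Rightarrow> \<top>
        | Some (x, t) \<Rightarrow> min \<top> (of_nat t + truncated_cost N \<Phi> (f x))) \<partial>measure_pmf p)"
  proof (intro nn_integral_mono)
    fix z :: "('b \<times> nat) option"
    have "(\<integral>\<^sup>+ w. ?\<phi> w \<partial>measure_pmf (map_spmf (\<lambda>(y, t'). (y, t + t')) (f x)))
        \<le> of_nat t + truncated_cost N \<Phi> (f x)" for x t
    proof -
      have "(\<integral>\<^sup>+ w. ?\<phi> w \<partial>measure_pmf (map_spmf (\<lambda>(y, t'). (y, t + t')) (f x)))
          = (\<integral>\<^sup>+ w. ?\<phi> (map_option (\<lambda>(y, t'). (y, t + t')) w) \<partial>measure_pmf (f x))"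
        by simp
      also have "\<dots> \<le> (\<integral>\<^sup>+ w. of_nat t + ?\<phi> w \<partial>measure_pmf (f x))"
      proof (intro nn_integral_mono)
        fix w :: "('a \<times> nat) option"
        have "min N (of_nat t + a) \<le> of_nat t + min N a" for a :: ennreal
        proof (cases "N \<le> a")
          case True
          have "min N (of_nat t + a) \<le> N" by simp
          also have "\<dots> \<le> of_nat t + N" by (rule add_increasing) simp_all
          finally show ?thesis using True by (simp only: min_absorb1)
        next
          case False
          then have "min N a = a" by simp
          then show ?thesis by (simp only: min.cobounded2)
        qed
        then show "?\<phi> (map_option (\<lambda>(y, t'). (y, t + t')) w) \<le> of_nat t + ?\<phi> w"
          by (auto split: option.splits simp: add.assoc)
      qed
      also have "\<dots> = of_nat t + truncated_cost N \<Phi> (f x)"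
        unfolding truncated_cost_def by (subst nn_integral_add) auto
      finally show ?thesis .
    qed
    then show "(\<integral>\<^sup>+ w. ?\<phi> w \<partial>measure_pmf (case z of None \<Rightarrow> return_pmf None
        | Some (x, t) \<Rightarrow> map_spmf (\<lambda>(y, t'). (y, t + t')) (f x)))
      \<le> (case z of None \<Rightarrow> \<top> | Some (x, t) \<Rightarrow> min \<top> (of_nat t + truncated_cost N \<Phi> (f x)))"
      by (cases z) auto
  qed
  finally show ?thesis
    unfolding truncated_cost_def[of \<top>] .
qed

lemma expected_cost_lift_timed: "expected_cost \<Phi> (lift_timed p) = of_nat (snd p) + \<Phi> (fst p)"
  by (simp add: truncated_cost_def lift_timed_def split_beta)

lemma expected_cost_sample: "expected_cost \<Phi> (sample (spmf_of_pmf q)) = 1 + (\<integral>\<^sup>+ x. \<Phi> x \<partial>measure_pmf q)"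
proof -
  have "expected_cost \<Phi> (sample (spmf_of_pmf q)) = (\<integral>\<^sup>+ x. 1 + \<Phi> x \<partial>measure_pmf q)"
    by (simp add: truncated_cost_def sample_def charge_def spmf_of_pmf_def)
  also have "\<dots> = 1 + (\<integral>\<^sup>+ x. \<Phi> x \<partial>measure_pmf q)"
    by (subst nn_integral_add) auto
  finally show ?thesis .
qed

text \<open>The bound for a walk is uniform in its current node, so the random in-neighbour may be
  replaced by the worst one.\<close>

lemma expected_cost_sample_set_le:
  assumes "finite S" and "S \<noteq> {}" and "\<And>x. \<Phi> x \<le> b"
  shows "expected_cost \<Phi> (sample (spmf_of_set S)) \<le> 1 + b"
proof -
  have "(\<integral>\<^sup>+ x. \<Phi> x \<partial>measure_pmf (pmf_of_set S)) \<le> (\<integral>\<^sup>+ x. b \<partial>measure_pmf (pmf_of_set S))"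
    by (intro nn_integral_mono assms)
  then have "(\<integral>\<^sup>+ x. \<Phi> x \<partial>measure_pmf (pmf_of_set S)) \<le> b" by simp
  moreover have "spmf_of_set S = spmf_of_pmf (pmf_of_set S)"
    using assms by (simp add: spmf_of_pmf_pmf_of_set)
  ultimately show ?thesis
    by (simp only: expected_cost_sample add_left_mono)
qed

lemma truncated_cost_bind_charge_le:
  "truncated_cost N \<Phi> (bind_rand (lift_timed (charge x)) f) \<le> 1 + truncated_cost N \<Phi> (f x)"
  using truncated_cost_bind_le[of N \<Phi> "lift_timed (charge x)" f]
  by (simp add: expected_cost_lift_timed charge_def)

text \<open>Monotone convergence. On diverging runs the caps increase to \<top>, so a finite bound
  common to all truncated costs also rules out a positive probability of divergence.\<close>

lemma expected_cost_SUP: "expected_cost \<Phi> p = (SUP n::nat. truncated_cost (of_nat n) \<Phi> p)"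
proof -
  have min_SUP: "(SUP n::nat. min (of_nat n) a) = a" for a :: ennreal
    using inf_SUP[of a "of_nat :: nat \<Rightarrow> ennreal" UNIV]
    by (simp add: ennreal_SUP_of_nat_eq_top inf_min min.commute)
  have "(SUP n::nat. truncated_cost (of_nat n) \<Phi> p)
      = (\<integral>\<^sup>+ z. (SUP n::nat. case z of None \<Rightarrow> of_nat n
           | Some (x, t) \<Rightarrow> min (of_nat n) (of_nat t + \<Phi> x)) \<partial>measure_pmf p)"
    unfolding truncated_cost_def
    by (intro nn_integral_monotone_convergence_SUP[symmetric])
      (auto simp: incseq_def le_fun_def simp del: min.bounded_iff split: option.splits intro!: min.mono)
  also have "\<dots> = expected_cost \<Phi> p"
    unfolding truncated_cost_def
    by (intro nn_integral_cong) (auto split: option.splits simp: min_SUP ennreal_SUP_of_nat_eq_top)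
  finally show ?thesis by simp
qed

section \<open>The random walks and their counters\<close>

abbreviation (input) keys_cost :: "('k, 'b) sparse \<Rightarrow> ennreal" where
  "keys_cost H \<equiv> ennreal (2 * real (length (keys H)))"

text \<open>
  Truncation at \<open>N\<close> also charges non-termination only \<open>N\<close>, so unrolling the walk \<open>k\<close> times leaves an
  error of at most \<open>N * sqrt c ^ k\<close>; letting \<open>k\<close> and then \<open>N\<close> tend to infinity yields almost sure
  termination and the expected cost at once.
\<close>

lemma truncated_cost_sqrt_walk_le:
  assumes c: "0 < c" "c < 1"
  shows "truncated_cost (of_nat N) keys_cost (sqrt_walk A c l x H)
    \<le> ennreal (2 * real (length (keys H)) + 5 / (1 - sqrt c) + real N * sqrt c ^ k)"
proof (induction k arbitrary: l x H)
  case 0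
  have "truncated_cost (of_nat N) keys_cost (sqrt_walk A c l x H) \<le> ennreal (real N)"
    using truncated_cost_le_bound by (simp add: ennreal_of_nat_eq_real_of_nat)
  also have "\<dots> \<le> ennreal (2 * real (length (keys H)) + 5 / (1 - sqrt c) + real N * sqrt c ^ 0)"
    using c by (intro ennreal_leI) simp
  finally show ?case .
next
  case (Suc k)
  define s where "s = sqrt c"
  have s: "0 < s" "s < 1" using c by (simp_all add: s_def)
  \<comment> \<open>A round costs 1 for the coin, then at most 4 for a jump (sample, update, and 2
    for a possibly new key) or 1 for a stop: \<open>1 + 4 * s + (1 - s) = 2 + 3 * s \<le> 5\<close>.
    The value \<open>d\<close> solves \<open>d = 5 + s * d\<close>.\<close>
  define d where "d = 5 / (1 - s)"
  have d: "0 \<le> d" "d = 5 + s * d" using s by (simp_all add: d_def field_simps)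
  define n where "n = 2 * real (length (keys H))"
  have n: "0 \<le> n" by (simp add: n_def)
  let ?T = "\<lambda>p. truncated_cost (of_nat N) (keys_cost :: (nat \<times> 'a, nat) sparse \<Rightarrow> ennreal) p"
  let ?stop = "lift_timed (charge H)"
  let ?jump = "do {
       y \<leftarrow> sample (spmf_of_set (set (in_list A x)));
       H \<leftarrow> lift_timed (charge (add_at (Suc l, y) 1 H));
       sqrt_walk A c (Suc l) y H
     }"
  let ?next = "\<lambda>continues. if continues \<and> in_list A x \<noteq> [] then ?jump else ?stop"
  have stop: "?T ?stop \<le> ennreal (1 + n)"
    using truncated_cost_le_expected_cost[of "of_nat N" keys_cost ?stop] n
    by (simp add: expected_cost_lift_timed charge_def n_def)
  have "?T ?jump \<le> ennreal (4 + n + d + real N * s ^ k)" if "in_list A x \<noteq> []"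
  proof -
    have "?T (do {
         H \<leftarrow> lift_timed (charge (add_at (Suc l, y) 1 H));
         sqrt_walk A c (Suc l) y H
       }) \<le> ennreal (3 + n + d + real N * s ^ k)" for y
    proof -
      have "?T (do {
         H \<leftarrow> lift_timed (charge (add_at (Suc l, y) 1 H));
         sqrt_walk A c (Suc l) y H
       }) \<le> 1 + ?T (sqrt_walk A c (Suc l) y (add_at (Suc l, y) 1 H))"
        by (rule truncated_cost_bind_charge_le)
      also have "\<dots> \<le> 1 + ennreal (2 * real (length (keys (add_at (Suc l, y) 1 H))) + d + real N * s ^ k)"
        unfolding d_def s_def by (intro add_left_mono Suc.IH)
      also have "\<dots> \<le> ennreal 1 + ennreal (2 + n + d + real N * s ^ k)"
      proof (rule add_mono)
        show "ennreal (2 * real (length (keys (add_at (Suc l, y) 1 H))) + d + real N * s ^ k)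
            \<le> ennreal (2 + n + d + real N * s ^ k)"
          using length_keys_add_at[of "(Suc l, y)" 1 H] unfolding n_def
          by (intro ennreal_leI) linarith
      qed simp
      also have "\<dots> = ennreal (3 + n + d + real N * s ^ k)"
        using n d s by (subst ennreal_plus[symmetric]) auto
      finally show ?thesis .
    qed
    then have "?T ?jump \<le> 1 + ennreal (3 + n + d + real N * s ^ k)"
      using that by (intro order_trans[OF truncated_cost_bind_le expected_cost_sample_set_le]) auto
    also have "\<dots> = ennreal 1 + ennreal (3 + n + d + real N * s ^ k)"
      by simp
    also have "\<dots> = ennreal (4 + n + d + real N * s ^ k)"
      using n d s by (subst ennreal_plus[symmetric]) auto
    finally show ?thesis .
  qed
  \<comment> \<open>If the coin says continue at a node without in-neighbours, the walk stops as
    well; the estimate for a jump covers this case.\<close>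
  moreover have "?T ?stop \<le> ennreal (4 + n + d + real N * s ^ k)"
    using stop by (rule order_trans) (use d s in \<open>simp add: ennreal_leI\<close>)
  ultimately have next_True: "?T (?next True) \<le> ennreal (4 + n + d + real N * s ^ k)"
    by simp
  have next_False: "?T (?next False) \<le> ennreal (1 + n)"
    using stop by simp
  have "?T (sqrt_walk A c l x H)
      \<le> expected_cost (\<lambda>b. ?T (?next b)) (sample (spmf_of_pmf (bernoulli_pmf s)))"
    by (subst sqrt_walk.simps) (use truncated_cost_bind_le in \<open>simp add: s_def\<close>)
  also have "\<dots> = 1 + (?T (?next True) * ennreal s + ?T (?next False) * ennreal (1 - s))"
    using s by (simp add: expected_cost_sample)
  also have "\<dots> \<le> ennreal 1 + (ennreal (4 + n + d + real N * s ^ k) * ennreal s + ennreal (1 + n) * ennreal (1 - s))"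
    using next_True next_False by (intro add_mono mult_right_mono) auto
  also have "\<dots> = ennreal (1 + ((4 + n + d + real N * s ^ k) * s + (1 + n) * (1 - s)))"
  proof -
    have "0 \<le> 4 + n + d + real N * s ^ k" "0 \<le> 1 + n" "0 \<le> s" "0 \<le> 1 - s"
      using n d s by simp_all
    then show ?thesis
      by (simp only: ennreal_mult[symmetric] ennreal_plus[symmetric] mult_nonneg_nonneg
          add_nonneg_nonneg zero_le_one)
  qed
  also have "\<dots> \<le> ennreal (n + d + real N * s ^ Suc k)"
  proof (rule ennreal_leI)
    have "1 + ((4 + n + d + real N * s ^ k) * s + (1 + n) * (1 - s))
        = 2 + 3 * s + n + s * d + real N * s ^ Suc k"
      by (simp add: algebra_simps)
    then show "1 + ((4 + n + d + real N * s ^ k) * s + (1 + n) * (1 - s)) \<le> n + d + real N * s ^ Suc k"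
      using d s by linarith
  qed
  finally show ?case
    by (simp add: n_def d_def s_def)
qed

lemma expected_cost_sqrt_walk_le:
  assumes c: "0 < c" "c < 1"
  shows "expected_cost keys_cost (sqrt_walk A c l x H)
    \<le> keys_cost H + ennreal (5 / (1 - sqrt c))"
proof -
  have s: "0 < sqrt c" "sqrt c < 1" using c by simp_all
  have "truncated_cost (of_nat N) keys_cost (sqrt_walk A c l x H)
      \<le> ennreal (2 * real (length (keys H)) + 5 / (1 - sqrt c))" for N
  proof (rule LIMSEQ_le_const)
    have "(\<lambda>k. 2 * real (length (keys H)) + 5 / (1 - sqrt c) + real N * sqrt c ^ k)
        \<longlonglongrightarrow> 2 * real (length (keys H)) + 5 / (1 - sqrt c) + real N * 0"
      using s by (intro tendsto_intros LIMSEQ_realpow_zero) auto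
    then show "(\<lambda>k. ennreal (2 * real (length (keys H)) + 5 / (1 - sqrt c) + real N * sqrt c ^ k))
        \<longlonglongrightarrow> ennreal (2 * real (length (keys H)) + 5 / (1 - sqrt c))"
      by (intro tendsto_ennrealI) simp
  qed (intro exI allI impI truncated_cost_sqrt_walk_le[OF c])
  then have "expected_cost keys_cost (sqrt_walk A c l x H)
      \<le> ennreal (2 * real (length (keys H)) + 5 / (1 - sqrt c))"
    unfolding expected_cost_SUP by (intro SUP_least)
  also have "\<dots> = keys_cost H + ennreal (5 / (1 - sqrt c))"
    using s by (intro ennreal_plus) auto
  finally show ?thesis .
qed

text \<open>Each walk raises time plus potential by at most a constant in expectation, whatever
  table it starts from. Hence the induction on \<open>n\<close> runs for arbitrary
  \<open>H\<close>.\<close>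

lemma expected_cost_sqrt_walks_le:
  assumes c: "0 < c" "c < 1"
  shows "expected_cost keys_cost (sqrt_walks n A c u H)
    \<le> keys_cost H + ennreal (real n * (1 + 5 / (1 - sqrt c)) + 1)"
proof (induction n arbitrary: H)
  case 0
  then show ?case
    by (simp add: expected_cost_lift_timed charge_def add.commute)
next
  case (Suc n)
  define d where "d = 5 / (1 - sqrt c)"
  have d: "0 \<le> d" using c by (simp add: d_def)
  have "expected_cost keys_cost (sqrt_walks (Suc n) A c u H)
      \<le> 1 + expected_cost keys_cost (do {H \<leftarrow> sqrt_walk A c 0 u H; sqrt_walks n A c u H})"
    unfolding sqrt_walks.simps by (rule truncated_cost_bind_charge_le)
  also have "\<dots> \<le> 1 + expected_cost (\<lambda>H. expected_cost keys_cost (sqrt_walks n A c u H)) (sqrt_walk A c 0 u H)"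
    by (intro add_left_mono truncated_cost_bind_le)
  also have "\<dots> \<le> 1 + expected_cost (\<lambda>H. keys_cost H + ennreal (real n * (1 + d) + 1)) (sqrt_walk A c 0 u H)"
    unfolding d_def by (intro add_left_mono truncated_cost_mono Suc.IH)
  also have "\<dots> \<le> 1 + ((keys_cost H + ennreal d) + ennreal (real n * (1 + d) + 1))"
    unfolding d_def
    by (intro add_left_mono order_trans[OF expected_cost_add_const] add_right_mono
        expected_cost_sqrt_walk_le c)
  also have "\<dots> = keys_cost H + (ennreal 1 + (ennreal d + ennreal (real n * (1 + d) + 1)))"
    by (simp add: ac_simps)
  also have "\<dots> = keys_cost H + ennreal (1 + (d + (real n * (1 + d) + 1)))"
    using d by (simp add: ennreal_plus[symmetric] del: ennreal_plus ennreal_1)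
  also have "1 + (d + (real n * (1 + d) + 1)) = real (Suc n) * (1 + d) + 1"
    by (simp add: algebra_simps)
  finally show ?case
    unfolding d_def .
qed

section \<open>Expected time of the whole algorithm\<close>

lemma (in adjacency_digraph) expected_time_simpush_le:
  assumes u: "u \<in> pverts G" and c: "0 < c" "c < 1" and eh: "0 < eps_h c \<epsilon>"
    and K: "1 / ((1 - sqrt c) * eps_h c \<epsilon>) < real K + 1"
  shows "expected_time (simpush A u c \<epsilon> \<delta>)
    \<le> ennreal (real (num_walks c \<epsilon> \<delta>) * (1 + 5 / (1 - sqrt c)) + 7 + real (stages_cost (L_star c \<epsilon>) K))"
proof -
  define n where "n = num_walks c \<epsilon> \<delta>"
  define W where "W = real n * (1 + 5 / (1 - sqrt c)) + 1"
  have W: "0 \<le> W" using c by (simp add: W_def)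
  define S where "S = real (2 + stages_cost (L_star c \<epsilon>) K)"
  let ?stages = "\<lambda>H. do {
       L \<leftarrow> detect_level H (X_param c \<epsilon> \<delta> / eps_h c \<epsilon>) (L_star c \<epsilon>);
       (h, g) \<leftarrow> source_push A c u L;
       att \<leftarrow> attention_nodes (eps_h c \<epsilon>) L h;
       ht \<leftarrow> graph_hits A c L h g att;
       r \<leftarrow> initial_residues L h att ht;
       s \<leftarrow> reverse_push A c (eps_h c \<epsilon>) L r;
       output_scores A u s
     }"
  have "expected_time (simpush A u c \<epsilon> \<delta>)
      \<le> 1 + (1 + (1 + (1 + expected_cost (\<lambda>_. 0) (do {
           H \<leftarrow> sqrt_walks n A c u empty_sparse; lift_timed (?stages H)}))))"
    unfolding expected_time_eq simpush_def n_def
    by (intro order_trans[OF truncated_cost_bind_charge_le] add_left_mono order_refl)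
  also have "\<dots> \<le> 1 + (1 + (1 + (1 + (ennreal W + ennreal S))))"
  proof (intro add_left_mono)
    have "expected_cost (\<lambda>_. 0) (do {H \<leftarrow> sqrt_walks n A c u empty_sparse; lift_timed (?stages H)})
        \<le> expected_cost (\<lambda>H. expected_cost (\<lambda>_. 0) (lift_timed (?stages H))) (sqrt_walks n A c u empty_sparse)"
      by (rule truncated_cost_bind_le)
    \<comment> \<open>Here the potential pays for the scan in \<open>detect_level\<close>;
      everything else after the walks is the constant \<open>S\<close>.\<close>
    also have "\<dots> \<le> expected_cost (\<lambda>H. keys_cost H + ennreal S) (sqrt_walks n A c u empty_sparse)"
    proof (intro truncated_cost_mono)
      fix H :: "(nat \<times> 'v, nat) sparse"
      have "snd (?stages H) \<le> 2 * length (keys H) + 2 + stages_cost (L_star c \<epsilon>) K"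
        using stages_run[OF u c eh K, of H "X_param c \<epsilon> \<delta> / eps_h c \<epsilon>" "L_star c \<epsilon>"]
        unfolding runs_within_def by (rule conjunct1)
      then have "real (snd (?stages H)) \<le> 2 * real (length (keys H)) + S"
        unfolding S_def by linarith
      then have "ennreal (real (snd (?stages H))) \<le> ennreal (2 * real (length (keys H)) + S)"
        by (rule ennreal_leI)
      then show "expected_cost (\<lambda>_. 0) (lift_timed (?stages H)) \<le> keys_cost H + ennreal S"
        by (simp only: expected_cost_lift_timed ennreal_of_nat_eq_real_of_nat add_0_right)
          (simp add: S_def)
    qed
    also have "\<dots> \<le> expected_cost keys_cost (sqrt_walks n A c u empty_sparse) + ennreal S"
      by (rule expected_cost_add_const)
    also have "\<dots> \<le> ennreal W + ennreal S"
      using expected_cost_sqrt_walks_le[OF c, of n A u empty_sparse]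
      by (intro add_right_mono) (simp add: W_def)
    finally show "expected_cost (\<lambda>_. 0) (do {
        H \<leftarrow> sqrt_walks n A c u empty_sparse; lift_timed (?stages H)}) \<le> ennreal W + ennreal S" .
  qed
  also have "\<dots> = ennreal 1 + (ennreal 1 + (ennreal 1 + (ennreal 1 + (ennreal W + ennreal S))))"
    by simp
  also have "\<dots> = ennreal (1 + (1 + (1 + (1 + (W + S)))))"
    using W by (simp add: S_def ennreal_plus[symmetric] del: ennreal_plus ennreal_1)
  \<comment> \<open>The 7 collects four parameter assignments, the final test of the walk loop, and
    the two operations of \<open>detect_level\<close> that are independent of the number of
    keys.\<close>
  also have "1 + (1 + (1 + (1 + (W + S)))) = real n * (1 + 5 / (1 - sqrt c)) + 7 + real (stages_cost (L_star c \<epsilon>) K)"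
    by (simp add: W_def S_def)
  finally show ?thesis
    unfolding n_def .
qed

section \<open>Absorbing the lower order terms\<close>

text \<open>A constant factor inside a logarithm is an additive constant outside; it becomes a
  multiplicative one because the logarithm stays above \<open>a\<^sub>0 > 0\<close>.\<close>

lemma absorb_constant:
  fixes a a\<^sub>0 x :: real
  assumes "0 < a\<^sub>0" and "a\<^sub>0 \<le> a"
  shows "x + a \<le> (1 + \<bar>x\<bar> / a\<^sub>0) * a"
proof -
  have "x \<le> \<bar>x\<bar> / a\<^sub>0 * a\<^sub>0" using assms by simp
  also have "\<dots> \<le> \<bar>x\<bar> / a\<^sub>0 * a" using assms by (intro mult_left_mono) auto
  finally show ?thesis by (simp add: algebra_simps)
qed

lemma L_star_le:
  assumes c: "0 < c" "c < 1" and \<epsilon>: "0 < \<epsilon>" and a: "0 < a\<^sub>0" "a\<^sub>0 \<le> ln (1 / \<epsilon>)"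
  shows "real (L_star c \<epsilon>)
    \<le> (1 + \<bar>- ln (eps_h c 1)\<bar> / a\<^sub>0) / ln (1 / sqrt c) * ln (1 / \<epsilon>)"
proof -
  have pos: "0 < eps_h c 1" "0 < ln (1 / sqrt c)" and eq: "eps_h c \<epsilon> = eps_h c 1 * \<epsilon>"
    using c by (simp_all add: eps_h_def)
  have "ln (1 / eps_h c \<epsilon>) = - ln (eps_h c 1) + ln (1 / \<epsilon>)"
    unfolding eq using pos \<epsilon> by (simp add: ln_div ln_mult)
  also have "\<dots> \<le> (1 + \<bar>- ln (eps_h c 1)\<bar> / a\<^sub>0) * ln (1 / \<epsilon>)"
    by (rule absorb_constant[OF a])
  finally have le: "log (1 / sqrt c) (1 / eps_h c \<epsilon>)
      \<le> (1 + \<bar>- ln (eps_h c 1)\<bar> / a\<^sub>0) / ln (1 / sqrt c) * ln (1 / \<epsilon>)"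
    using pos(2) by (simp add: log_def divide_right_mono)
  \<comment> \<open>The logarithm may be negative and \<open>nat\<close> then returns 0, so the
    right-hand side must be known to be nonnegative.\<close>
  have "0 \<le> (1 + \<bar>- ln (eps_h c 1)\<bar> / a\<^sub>0) / ln (1 / sqrt c) * ln (1 / \<epsilon>)"
    using pos(2) a by (intro mult_nonneg_nonneg divide_nonneg_nonneg add_nonneg_nonneg) auto
  with le show ?thesis
    unfolding L_star_def by linarith
qed

text \<open>The \<open>+ 1\<close> pays for the ceiling. As with \<open>L_star\<close>,
  nonnegativity of the right-hand side settles the case of negative \<open>X_param\<close>.\<close>

lemma num_walks_le:
  assumes c: "0 < c" "c < 1" and \<epsilon>: "0 < \<epsilon>" and \<delta>: "0 < \<delta>"
    and b: "0 < a\<^sub>0" "a\<^sub>0 \<le> ln (1 / (\<epsilon> * \<delta>))"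
  shows "real (num_walks c \<epsilon> \<delta>)
    \<le> 2 * (1 + \<bar>- ln ((1 - sqrt c) * eps_h c 1)\<bar> / a\<^sub>0) / (eps_h c 1)\<^sup>2 * (ln (1 / (\<epsilon> * \<delta>)) / \<epsilon>\<^sup>2) + 1"
proof -
  define x where "x = 1 + \<bar>- ln ((1 - sqrt c) * eps_h c 1)\<bar> / a\<^sub>0"
  have pos: "0 < (1 - sqrt c) * eps_h c 1" "0 < eps_h c 1" and eq: "eps_h c \<epsilon> = eps_h c 1 * \<epsilon>"
    using c by (simp_all add: eps_h_def)
  have "X_param c \<epsilon> \<delta> = ln (1 / (((1 - sqrt c) * eps_h c 1) * (\<epsilon> * \<delta>)))"
    by (simp add: X_param_def eq ac_simps)
  also have "\<dots> = - ln ((1 - sqrt c) * eps_h c 1) + ln (1 / (\<epsilon> * \<delta>))"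
  proof -
    have "ln (1 / (p * q)) = - ln p + ln (1 / q)" if "0 < p" "0 < q" for p q :: real
      using that by (simp add: ln_div ln_mult)
    then show ?thesis
      using pos(1) \<epsilon> \<delta> by simp
  qed
  also have "\<dots> \<le> x * ln (1 / (\<epsilon> * \<delta>))"
    unfolding x_def by (rule absorb_constant[OF b])
  finally have X: "X_param c \<epsilon> \<delta> \<le> x * ln (1 / (\<epsilon> * \<delta>))" .
  have "2 * X_param c \<epsilon> \<delta> / (eps_h c \<epsilon>)\<^sup>2 \<le> 2 * (x * ln (1 / (\<epsilon> * \<delta>))) / (eps_h c \<epsilon>)\<^sup>2"
    using X by (intro divide_right_mono) auto
  also have "\<dots> = 2 * x / (eps_h c 1)\<^sup>2 * (ln (1 / (\<epsilon> * \<delta>)) / \<epsilon>\<^sup>2)"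
    by (simp add: eq power_mult_distrib)
  finally have le: "2 * X_param c \<epsilon> \<delta> / (eps_h c \<epsilon>)\<^sup>2 \<le> 2 * x / (eps_h c 1)\<^sup>2 * (ln (1 / (\<epsilon> * \<delta>)) / \<epsilon>\<^sup>2)" .
  have "0 \<le> x"
    using b by (simp add: x_def)
  then have "0 \<le> 2 * x / (eps_h c 1)\<^sup>2 * (ln (1 / (\<epsilon> * \<delta>)) / \<epsilon>\<^sup>2)"
    using b by (intro mult_nonneg_nonneg divide_nonneg_nonneg) auto
  with le show ?thesis
    unfolding num_walks_def x_def[symmetric] by linarith
qed

text \<open>As \<open>a \<le> y\<close>, both L and K are O(y), so monomials without m, of degree at
  most three, go to \<open>y ^ 3\<close>. Those with m need a factor a: L supplies it, except in the
  bare \<open>8 * m\<close> for initialisation and output, where \<open>a\<^sub>0 \<le> a\<close> is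
  used.\<close>

lemma absorb_monomials:
  fixes m L K a y a\<^sub>0 lam kap :: real
  assumes nonneg: "0 \<le> m" "0 \<le> L" "0 \<le> K" "0 \<le> lam" "0 \<le> kap"
    and L: "L \<le> lam * a" and K: "K \<le> kap * y"
    and a: "0 < a\<^sub>0" "a\<^sub>0 \<le> a" "a \<le> y" and y: "1 \<le> y"
  shows "9 + 13 * L + 15 * (L * m) + 6 * (L * K) + 4 * (L * K * m) + 6 * K + 6 * K\<^sup>2
      + 2 * (L * K\<^sup>2) + 2 * K ^ 3 + 8 * m
    \<le> (9 + 13 * lam + 6 * (lam * kap) + 6 * kap + 6 * kap\<^sup>2 + 2 * (lam * kap\<^sup>2) + 2 * kap ^ 3) * y ^ 3
      + (15 * lam + 4 * (lam * kap) + 8 / a\<^sub>0) * (m * a * y)"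
proof -
  have powers: "1 \<le> y ^ 3" "y \<le> y ^ 3" "y\<^sup>2 \<le> y ^ 3"
    using y power_increasing[of 1 3 y] power_increasing[of 2 3 y] one_le_power[of y 3] by simp_all
  have Ly: "L \<le> lam * y"
    using L mult_left_mono[OF a(3) nonneg(4)] by linarith
  have "L \<le> lam * y ^ 3"
    using Ly mult_left_mono[OF powers(2) nonneg(4)] by linarith
  moreover have "L * m \<le> lam * (m * a * y)"
  proof -
    have "L * m \<le> lam * a * m" using L nonneg by (intro mult_right_mono)
    also have "\<dots> = lam * a * m * 1" by simp
    also have "\<dots> \<le> lam * a * m * y" using nonneg a y by (intro mult_left_mono) auto
    finally show ?thesis by (simp add: ac_simps)
  qed
  moreover have "L * K \<le> lam * kap * y ^ 3"
  proof -
    have "L * K \<le> (lam * y) * (kap * y)"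
      using Ly K nonneg y by (intro mult_mono) auto
    also have "\<dots> = lam * kap * y\<^sup>2" by (simp add: power2_eq_square)
    also have "\<dots> \<le> lam * kap * y ^ 3" using nonneg powers by (intro mult_left_mono) auto
    finally show ?thesis .
  qed
  moreover have "L * K * m \<le> lam * kap * (m * a * y)"
  proof -
    have "L * K \<le> (lam * a) * (kap * y)"
      using L K nonneg a by (intro mult_mono) auto
    then have "L * K * m \<le> (lam * a) * (kap * y) * m"
      using nonneg by (intro mult_right_mono)
    then show ?thesis by (simp add: ac_simps)
  qed
  moreover have "K \<le> kap * y ^ 3"
    using K mult_left_mono[OF powers(2) nonneg(5)] by linarith
  moreover have "K\<^sup>2 \<le> kap\<^sup>2 * y ^ 3"
  proof -
    have "K\<^sup>2 \<le> (kap * y)\<^sup>2" using K nonneg by (intro power_mono)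
    also have "\<dots> = kap\<^sup>2 * y\<^sup>2" by (rule power_mult_distrib)
    also have "\<dots> \<le> kap\<^sup>2 * y ^ 3" using powers by (intro mult_left_mono) auto
    finally show ?thesis .
  qed
  moreover have "L * K\<^sup>2 \<le> lam * kap\<^sup>2 * y ^ 3"
  proof -
    have "L * K\<^sup>2 \<le> (lam * y) * (kap * y)\<^sup>2"
      using Ly K nonneg y by (intro mult_mono power_mono) auto
    then show ?thesis by (simp add: power_mult_distrib power2_eq_square power3_eq_cube ac_simps)
  qed
  moreover have "K ^ 3 \<le> kap ^ 3 * y ^ 3"
    using power_mono[OF K nonneg(3), of 3] by (simp add: power_mult_distrib)
  moreover have "m \<le> 1 / a\<^sub>0 * (m * a * y)"
  proof -
    have "a\<^sub>0 * 1 \<le> a * y" using a y by (intro mult_mono) auto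
    then have "m * (a\<^sub>0 * 1) \<le> m * (a * y)" using nonneg by (intro mult_left_mono)
    then show ?thesis using a by (simp add: field_simps)
  qed
  ultimately have "9 + 13 * L + 15 * (L * m) + 6 * (L * K) + 4 * (L * K * m) + 6 * K + 6 * K\<^sup>2
      + 2 * (L * K\<^sup>2) + 2 * K ^ 3 + 8 * m
    \<le> 9 * y ^ 3 + 13 * (lam * y ^ 3) + 15 * (lam * (m * a * y)) + 6 * (lam * kap * y ^ 3)
      + 4 * (lam * kap * (m * a * y)) + 6 * (kap * y ^ 3) + 6 * (kap\<^sup>2 * y ^ 3)
      + 2 * (lam * kap\<^sup>2 * y ^ 3) + 2 * (kap ^ 3 * y ^ 3) + 8 * (1 / a\<^sub>0 * (m * a * y))"
    using powers(1) by linarith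
  then show ?thesis
    by (simp add: algebra_simps)
qed

lemma (in adjacency_digraph) real_stages_cost:
  "real (stages_cost L K) = 9 + 13 * real L + 15 * (real L * real m) + 6 * (real L * real K)
     + 4 * (real L * real K * real m) + 6 * real K + 6 * (real K)\<^sup>2 + 2 * (real L * (real K)\<^sup>2)
     + 2 * real K ^ 3 + 8 * real m"
  by (simp add: stages_cost_def algebra_simps power2_eq_square power3_eq_cube)

theorem theorem2:
  fixes c \<epsilon>\<^sub>0 :: real
  assumes "0 < c" and "c < 1" and "0 < \<epsilon>\<^sub>0" and "\<epsilon>\<^sub>0 < 1"
  shows "\<exists>C::real. \<forall>(G :: 'v pair_pre_digraph) (A :: 'v adjacency) (u :: 'v) (\<epsilon>::real) (\<delta>::real).
           pair_fin_digraph G \<longrightarrow> represents A G \<longrightarrow> u \<in> pverts G \<longrightarrow>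
           0 < \<epsilon> \<longrightarrow> \<epsilon> \<le> \<epsilon>\<^sub>0 \<longrightarrow> 0 < \<delta> \<longrightarrow> \<delta> < 1 \<longrightarrow>
           expected_time (simpush A u c \<epsilon> \<delta>)
             \<le> ennreal (C * (real (card (parcs G)) * ln (1 / \<epsilon>) / \<epsilon>
                              + ln (1 / (\<epsilon> * \<delta>)) / \<epsilon>\<^sup>2
                              + 1 / \<epsilon> ^ 3))"
proof -
  define a\<^sub>0 where "a\<^sub>0 = ln (1 / \<epsilon>\<^sub>0)"
  have a0: "0 < a\<^sub>0" using assms by (simp add: a\<^sub>0_def)
  \<comment> \<open>Since \<open>eps_h\<close> is linear in \<epsilon>, the coefficients contain it
    only at \<epsilon> = 1, and the dependence on \<epsilon> is left to \<open>a\<close>,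
    \<open>b\<close> and \<open>y\<close>.\<close>
  define lam where "lam = (1 + \<bar>- ln (eps_h c 1)\<bar> / a\<^sub>0) / ln (1 / sqrt c)"
  define kap where "kap = 1 / ((1 - sqrt c) * eps_h c 1)"
  define \<nu> where "\<nu> = 2 * (1 + \<bar>- ln ((1 - sqrt c) * eps_h c 1)\<bar> / a\<^sub>0) / (eps_h c 1)\<^sup>2"
  define d where "d = 1 + 5 / (1 - sqrt c)"
  define C\<^sub>1 where "C\<^sub>1 = 15 * lam + 4 * (lam * kap) + 8 / a\<^sub>0"
  define C\<^sub>3 where "C\<^sub>3 = 9 + 13 * lam + 6 * (lam * kap) + 6 * kap + 6 * kap\<^sup>2 + 2 * (lam * kap\<^sup>2) + 2 * kap ^ 3"
  \<comment> \<open>Three nonnegative coefficients, one per summand of the bound; their sum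
    dominates each. The part \<open>d + 7\<close> holds the costs free of \<epsilon>, \<delta> and
    \<open>m\<close>, absorbed by \<open>1 \<le> y ^ 3\<close>.\<close>
  define C where "C = C\<^sub>1 + \<nu> * d + (C\<^sub>3 + d + 7)"
  have eps_h_pos: "0 < eps_h c 1" using assms by (simp add: eps_h_def)
  have coeffs_nonneg: "0 \<le> lam" "0 \<le> kap" "0 \<le> \<nu>" "0 \<le> d"
    using assms a0 eps_h_pos by (simp_all add: lam_def kap_def \<nu>_def d_def)
  then have C_nonneg: "0 \<le> C\<^sub>1" "0 \<le> \<nu> * d" "0 \<le> C\<^sub>3 + d + 7"
    using a0 by (simp_all add: C\<^sub>1_def C\<^sub>3_def)
  show ?thesis
  proof (intro exI[of _ C] allI impI)
    fix G :: "'v pair_pre_digraph" and A :: "'v adjacency" and u :: 'v and \<epsilon> \<delta> :: real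
    assume G: "pair_fin_digraph G" and A: "represents A G" and u: "u \<in> pverts G"
      and \<epsilon>: "0 < \<epsilon>" "\<epsilon> \<le> \<epsilon>\<^sub>0" and \<delta>: "0 < \<delta>" "\<delta> < 1"
    interpret pair_fin_digraph G by (rule G)
    interpret adjacency_digraph G A by unfold_locales (rule A)
    define a where "a = ln (1 / \<epsilon>)"
    define b where "b = ln (1 / (\<epsilon> * \<delta>))"
    define y where "y = 1 / \<epsilon>"
    define L where "L = L_star c \<epsilon>"
    define K where "K = nat \<lfloor>1 / ((1 - sqrt c) * eps_h c \<epsilon>)\<rfloor>"
    have y: "1 \<le> y" using \<epsilon> assms by (simp add: y_def)
    have a: "a\<^sub>0 \<le> a" using \<epsilon> assms by (simp add: a\<^sub>0_def a_def ln_div)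
    \<comment> \<open>The inequality ln x \<le> x - 1 at x = 1/\<epsilon>; it makes the number of
      levels O(1/\<epsilon>).\<close>
    have "a \<le> y - 1"
      using ln_le_minus_one[of "1 / \<epsilon>"] \<epsilon> by (simp add: a_def y_def)
    then have ay: "a \<le> y" by simp
    \<comment> \<open>Because \<delta> < 1, the logarithm \<open>b\<close> inherits the lower bound
      \<open>a\<^sub>0\<close> from \<open>a\<close>, as \<open>num_walks_le\<close>
      requires.\<close>
    have "\<epsilon> * \<delta> \<le> \<epsilon>" using \<epsilon> \<delta> by (simp add: mult_left_le)
    then have ab: "a \<le> b" using \<epsilon> \<delta> by (simp add: a_def b_def ln_div ln_mult)
    have eh: "eps_h c \<epsilon> = eps_h c 1 * \<epsilon>" by (simp add: eps_h_def)
    have eh_pos: "0 < eps_h c \<epsilon>" unfolding eh using eps_h_pos \<epsilon> by simp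
    have kap_y: "1 / ((1 - sqrt c) * eps_h c \<epsilon>) = kap * y"
      by (simp add: kap_def y_def eh)
    have K_le: "real K \<le> kap * y" and K_gt: "1 / ((1 - sqrt c) * eps_h c \<epsilon>) < real K + 1"
      unfolding K_def kap_y using coeffs_nonneg(2) y by (simp_all add: floor_le_iff)
    have L_le: "real L \<le> lam * a"
      unfolding L_def lam_def a_def
      by (rule L_star_le[OF assms(1,2) \<epsilon>(1) a0 a[unfolded a_def]])
    have "a\<^sub>0 \<le> b" using a ab by linarith
    then have n_le: "real (num_walks c \<epsilon> \<delta>) \<le> \<nu> * (b * y\<^sup>2) + 1"
      using num_walks_le[OF assms(1,2) \<epsilon>(1) \<delta>(1) a0] by (simp add: \<nu>_def b_def y_def power_divide)
    have "real (stages_cost L K) \<le> C\<^sub>3 * y ^ 3 + C\<^sub>1 * (real m * a * y)"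
      unfolding real_stages_cost C\<^sub>1_def C\<^sub>3_def
      by (rule absorb_monomials) (use coeffs_nonneg L_le K_le a0 a ay y in auto)
    moreover have "real (num_walks c \<epsilon> \<delta>) * d \<le> (\<nu> * (b * y\<^sup>2) + 1) * d"
      using n_le coeffs_nonneg by (intro mult_right_mono)
    moreover have "d + 7 \<le> (d + 7) * y ^ 3"
      using coeffs_nonneg one_le_power[OF y, of 3] by simp
    ultimately have cost: "real (num_walks c \<epsilon> \<delta>) * d + 7 + real (stages_cost L K)
        \<le> C\<^sub>1 * (real m * a * y) + \<nu> * d * (b * y\<^sup>2) + (C\<^sub>3 + d + 7) * y ^ 3"
      by (simp add: algebra_simps)
    also have "\<dots> \<le> C * (real m * a * y) + C * (b * y\<^sup>2) + C * y ^ 3"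
    proof -
      have "C\<^sub>1 \<le> C" "\<nu> * d \<le> C" "C\<^sub>3 + d + 7 \<le> C"
        using C_nonneg unfolding C_def by linarith+
      moreover have "0 \<le> real m * a * y" "0 \<le> b * y\<^sup>2" "0 \<le> y ^ 3"
        using a0 a ab y by simp_all
      ultimately show ?thesis
        by (intro add_mono mult_right_mono)
    qed
    also have "\<dots> = C * (real m * ln (1 / \<epsilon>) / \<epsilon> + ln (1 / (\<epsilon> * \<delta>)) / \<epsilon>\<^sup>2 + 1 / \<epsilon> ^ 3)"
      by (simp add: a_def b_def y_def power_divide algebra_simps)
    finally show "expected_time (simpush A u c \<epsilon> \<delta>)
        \<le> ennreal (C * (real m * ln (1 / \<epsilon>) / \<epsilon> + ln (1 / (\<epsilon> * \<delta>)) / \<epsilon>\<^sup>2 + 1 / \<epsilon> ^ 3))"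
      using expected_time_simpush_le[OF u assms(1,2) eh_pos K_gt, of \<delta>]
      unfolding d_def L_def by (meson ennreal_leI order_trans)
  qed
qed

end
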